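(* Let $\mathcal{C}$ be a smooth analytic complex curve (i.e. a Riemann surface) and let $R>0$ be a real number. Let $u:\mathbb{D}(0,R)\to\mathcal{C}$ and $\lambda:\mathcal{C}\to\mathbb{C}$ be two holomorphic maps, and let $g$ be a complex-valued function defined and holomorphic in a neighbourhood of the closure $\overline{\{u(z): z\in\mathbb{D}(0,R)\}}\subset\mathcal{C}$. Denote by $\sum_{n\in\mathbb{N}} a_n z^n$ the power series expansion (near $z=0$) of the complex-valued function $g\circ u$. Assume that: i) $\lambda\circ u=\mathrm{id}_{\mathbb{D}(0,R)}$; ii) $u$ extends by continuity to a map $\overline{\mathbb{D}}(0,R)\to\mathcal{C}$ (still denoted $u$); iii) the first derivative of $\lambda$ at $p=u(R)$ is zero: $D_p\lambda=0$; iv) the second derivative of $\lambda$ at $p$ is non-zero: $D^2_p\lambda\neq 0$; v) $u$ extends holomorphically to a neighbourhood of any point of $\partial\mathbb{D}(0,R)\setminus\{R\}$; vi) the derivative of $g$ at $p$ is non-zero: $D_pg\neq 0$. Then there exist a unique non-zero constant $C$ and a unique sequence of constants $(c_l)_{l\geq 1}$ such that for any positive integer $K$, as $n\to\infty$, $$a_n=C R^{-n}\frac{1}{n^{3/2}}\left(1+\frac{c_1}{n}+\dots+\frac{c_K}{n^K}+O\left(\frac{1}{n^{K+1}}\right)\right).$$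
   Context: $\mathbb{D}(a,\rho)=\{z\in\mathbb{C}:|z-a|<\rho\}$ is the open disc and $\overline{\mathbb{D}}(a,\rho)$ its closure. Second derivative: if $c:\mathcal{U}_p\to\mathbb{C}$ is a holomorphic chart of $\mathcal{C}$ near $p$ with $c(p)=0$, the conditions $D_p\lambda=0$ and $D_p^2\lambda\ne0$ mean $(\lambda\circ c^{-1})'(0)=0$ and $(\lambda\circ c^{-1})''(0)\neq0$; given $D_p\lambda=0$, the condition $D^2_p\lambda\neq 0$ does not depend on the chart. "$u$ extends holomorphically to a neighbourhood of a boundary point $\zeta$" means there are an open neighbourhood $U$ of $\zeta$ in $\mathbb{C}$ and a holomorphic map $U\to\mathcal{C}$ agreeing with $u$ on $U\cap\mathbb{D}(0,R)$. *)

theory Defs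
  imports "HOL-Complex_Analysis.Complex_Analysis" "HOL-Library.Landau_Symbols"
begin

text \<open>
  A chart is a pair of an open set and a coordinate function. The coordinate is a total HOL
  function whose values outside the open set are irrelevant; the inverse of the chart
  \<open>(U, \<phi>)\<close> is \<open>inv_into U \<phi>\<close>, meaningful on \<open>\<phi> ` U\<close>.
\<close>

definition complex_chart :: "'a topology \<Rightarrow> 'a set \<Rightarrow> ('a \<Rightarrow> complex) \<Rightarrow> bool" where
  "complex_chart X U \<phi> \<longleftrightarrow>
     openin X U \<and> open (\<phi> ` U) \<and>
     homeomorphic_map (subtopology X U) (top_of_set (\<phi> ` U)) \<phi>"

definition compatible_charts ::
  "'a set \<Rightarrow> ('a \<Rightarrow> complex) \<Rightarrow> 'a set \<Rightarrow> ('a \<Rightarrow> complex) \<Rightarrow> bool" where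
  "compatible_charts U \<phi> V \<psi> \<longleftrightarrow>
     (\<psi> \<circ> inv_into U \<phi>) holomorphic_on \<phi> ` (U \<inter> V) \<and>
     (\<phi> \<circ> inv_into V \<psi>) holomorphic_on \<psi> ` (U \<inter> V)"

text \<open>
  A smooth complex curve: a Hausdorff space \<open>X\<close> with an atlas \<open>A\<close>, not necessarily maximal,
  whose transition maps are holomorphic. Neither connectedness nor second countability
  is imposed, so Riemann surfaces are covered whether or not these belong to their definition.
\<close>

definition complex_curve :: "'a topology \<Rightarrow> ('a set \<times> ('a \<Rightarrow> complex)) set \<Rightarrow> bool" where
  "complex_curve X A \<longleftrightarrow>
     Hausdorff_space X \<and>
     (\<forall>(U, \<phi>) \<in> A. complex_chart X U \<phi>) \<and>
     (\<forall>(U, \<phi>) \<in> A. \<forall>(V, \<psi>) \<in> A. compatible_charts U \<phi> V \<psi>) \<and>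
     (\<Union>(U, \<phi>) \<in> A. U) = topspace X"

text \<open>The holomorphic charts of the curve, i.e. the members of the maximal atlas containing \<open>A\<close>.\<close>

definition holomorphic_chart ::
  "'a topology \<Rightarrow> ('a set \<times> ('a \<Rightarrow> complex)) set \<Rightarrow> 'a set \<Rightarrow> ('a \<Rightarrow> complex) \<Rightarrow> bool" where
  "holomorphic_chart X A U \<phi> \<longleftrightarrow>
     complex_chart X U \<phi> \<and> (\<forall>(V, \<psi>) \<in> A. compatible_charts U \<phi> V \<psi>)"

definition holomorphic_function_on ::
  "'a topology \<Rightarrow> ('a set \<times> ('a \<Rightarrow> complex)) set \<Rightarrow> 'a set \<Rightarrow> ('a \<Rightarrow> complex) \<Rightarrow> bool" where
  "holomorphic_function_on X A W f \<longleftrightarrow>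
     openin X W \<and> (\<forall>(U, \<phi>) \<in> A. (f \<circ> inv_into U \<phi>) holomorphic_on \<phi> ` (U \<inter> W))"

text \<open>Holomorphic maps from an open set \<open>D\<close> of the complex plane to the curve.\<close>

definition holomorphic_map_into ::
  "'a topology \<Rightarrow> ('a set \<times> ('a \<Rightarrow> complex)) set \<Rightarrow> complex set \<Rightarrow> (complex \<Rightarrow> 'a) \<Rightarrow> bool" where
  "holomorphic_map_into X A D f \<longleftrightarrow>
     open D \<and> continuous_map (top_of_set D) X f \<and>
     (\<forall>(U, \<phi>) \<in> A. (\<phi> \<circ> f) holomorphic_on {z \<in> D. f z \<in> U})"

definition extends_holomorphically_near ::
  "'a topology \<Rightarrow> ('a set \<times> ('a \<Rightarrow> complex)) set \<Rightarrow> complex set \<Rightarrow> (complex \<Rightarrow> 'a) \<Rightarrow> complex \<Rightarrow> bool"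
  where
  "extends_holomorphically_near X A D f \<zeta> \<longleftrightarrow>
     (\<exists>V h. \<zeta> \<in> V \<and> holomorphic_map_into X A V h \<and> (\<forall>z \<in> V \<inter> D. h z = f z))"

text \<open>The sequence \<open>c\<close> is indexed from 1 on: the value \<open>c 0\<close> is not used.\<close>

definition coeff_expansion ::
  "(nat \<Rightarrow> complex) \<Rightarrow> real \<Rightarrow> complex \<Rightarrow> (nat \<Rightarrow> complex) \<Rightarrow> bool" where
  "coeff_expansion a R C c \<longleftrightarrow>
     (\<forall>K\<ge>1. \<exists>\<epsilon>. \<epsilon> \<in> O(\<lambda>n. 1 / of_nat n ^ (K + 1)) \<and>
        (\<forall>\<^sub>F n in sequentially.
           a n = C * (1 / of_real R ^ n) * (1 / of_real (real n powr (3/2))) *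
                 (1 + (\<Sum>l=1..K. c l / of_nat n ^ l) + \<epsilon> n)))"

end

theory Submission imports Defs begin

text \<open>
  At \<open>p\<close> the map \<open>\<lambda>\<close> has a simple critical point, so in a chart \<open>R - \<lambda>\<close> is the square of a local
  coordinate, and \<open>g \<circ> u\<close> is near \<open>R\<close> a holomorphic function \<open>G\<close> of \<open>sqrt (R - z)\<close> with \<open>G'(0) \<noteq> 0\<close>;
  it is holomorphic near every other point of the closed disc. By Darboux's method the coefficients
  are asymptotically those of the odd powers of \<open>sqrt (R - z)\<close>, i.e. generalised binomial
  coefficients, which have full expansions in powers of \<open>1 / n\<close>.
\<close>

section \<open>Expansions in powers of 1/n\<close>

text \<open>Darboux's method is run on the open disc alone: a bound on a high derivative there
  suffices, so no contour leaves the disc, and the extensions across the other boundary points are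
  used only locally and combined by compactness. What shapes the truncation is the point
  \<open>R\<close>: differentiating in \<open>z\<close> a holomorphic function of
  \<open>sqrt (R - z)\<close> costs two powers of the root, so a Taylor remainder with the factor
  \<open>sqrt (R - z) ^ (2 * M)\<close> stays bounded after \<open>M\<close> derivatives. The weight
  \<open>n powr (3/2)\<close> is the one natural for the first power of the root. Even powers are
  polynomials in \<open>z\<close> and affect finitely many coefficients; the power
  \<open>2 * j + 1\<close> enters only at relative order \<open>1 / n ^ j\<close>. Hence the leading
  constant is \<open>G'(0) * sqrt R / Gamma (- 1 / 2)\<close>, where \<open>G'(0)\<close> is nonzero
  because both the local coordinate and \<open>g\<close> have nonzero derivative at
  \<open>p\<close>. Each order \<open>K\<close> is treated on its own and yields its own polynomial;
  uniqueness of the coefficients is what turns these polynomials into one sequence, besides giving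
  the uniqueness claim.\<close>

text \<open>Only the coefficients of \<open>p\<close> of degree below \<open>K\<close> are determined by \<open>x\<close>.\<close>

definition inv_expansion :: "nat \<Rightarrow> (nat \<Rightarrow> complex) \<Rightarrow> complex poly \<Rightarrow> bool" where
  "inv_expansion K x p \<longleftrightarrow> (\<lambda>n. x n - poly p (1 / of_nat n)) \<in> O(\<lambda>n. 1 / of_nat n ^ K)"

lemma inverse_power_bigo_mono:
  assumes "K \<le> L"
  shows "(\<lambda>n. 1 / of_nat n ^ L :: complex) \<in> O(\<lambda>n. 1 / of_nat n ^ K)"
proof (rule bigoI)
  show "\<forall>\<^sub>F n in sequentially. norm (1 / of_nat n ^ L :: complex) \<le> 1 * norm (1 / of_nat n ^ K :: complex)"
    using eventually_gt_at_top[of 0]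
    by eventually_elim
      (use assms in \<open>auto simp: norm_divide norm_power intro!: divide_left_mono power_increasing\<close>)
qed

lemma inv_expansion_mono: "inv_expansion L x p \<Longrightarrow> K \<le> L \<Longrightarrow> inv_expansion K x p"
  unfolding inv_expansion_def
  by (erule landau_o.big_trans) (rule inverse_power_bigo_mono)

lemma poly_inverse_tendsto: "(\<lambda>n. poly p (1 / of_nat n :: complex)) \<longlonglongrightarrow> coeff p 0"
proof -
  have "(\<lambda>n. 1 / of_nat n :: complex) \<longlonglongrightarrow> 0"
    by (rule lim_1_over_n)
  then have "(\<lambda>n. poly p (1 / of_nat n :: complex)) \<longlonglongrightarrow> poly p 0"
    by (rule isCont_tendsto_compose[rotated]) (auto intro!: continuous_intros)
  then show ?thesis by (simp add: poly_0_coeff_0)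
qed

lemma poly_inverse_bigo: "(\<lambda>n. poly p (1 / of_nat n :: complex)) \<in> O(\<lambda>_. 1)"
  using poly_inverse_tendsto[of p] by (intro bigoI_tendsto[where c = "coeff p 0"]) auto

lemma inv_expansion_bigo:
  assumes "inv_expansion K x p"
  shows "x \<in> O(\<lambda>_. 1)"
proof -
  have "(\<lambda>n. 1 / of_nat n ^ K) \<in> O(\<lambda>_. 1 :: complex)"
    using inverse_power_bigo_mono[of 0 K] by simp
  then have "(\<lambda>n. x n - poly p (1 / of_nat n)) \<in> O(\<lambda>_. 1)"
    using assms unfolding inv_expansion_def by (rule landau_o.big_trans[rotated])
  from sum_in_bigo(1)[OF this poly_inverse_bigo[of p]] show ?thesis by simp
qed

lemma inv_expansion_add:
  "inv_expansion K x p \<Longrightarrow> inv_expansion K y q \<Longrightarrow> inv_expansion K (\<lambda>n. x n + y n) (p + q)"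
  unfolding inv_expansion_def
  by (drule (1) sum_in_bigo(1)) (simp add: algebra_simps)

lemma inv_expansion_poly: "inv_expansion K (\<lambda>n. poly p (1 / of_nat n)) p"
  by (simp add: inv_expansion_def)

lemma inv_expansion_bigo_0: "x \<in> O(\<lambda>n. 1 / of_nat n ^ K) \<Longrightarrow> inv_expansion K x 0"
  by (simp add: inv_expansion_def)

lemma inv_expansion_mult:
  assumes "inv_expansion K x p" "inv_expansion K y q"
  shows "inv_expansion K (\<lambda>n. x n * y n) (p * q)"
proof -
  have "(\<lambda>n. (x n - poly p (1 / of_nat n)) * y n) \<in> O(\<lambda>n. 1 / of_nat n ^ K * 1)"
    using assms inv_expansion_bigo by (intro landau_o.big.mult) (auto simp: inv_expansion_def)
  moreover have "(\<lambda>n. poly p (1 / of_nat n) * (y n - poly q (1 / of_nat n))) \<in> O(\<lambda>n. 1 * (1 / of_nat n ^ K))"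
    using assms poly_inverse_bigo by (intro landau_o.big.mult) (auto simp: inv_expansion_def)
  ultimately show ?thesis
    unfolding inv_expansion_def by (auto dest: sum_in_bigo(1) simp: algebra_simps)
qed

lemma inv_expansion_sum:
  assumes "finite I" "\<And>i. i \<in> I \<Longrightarrow> inv_expansion K (x i) (p i)"
  shows "inv_expansion K (\<lambda>n. \<Sum>i\<in>I. x i n) (\<Sum>i\<in>I. p i)"
  using assms
proof (induction I rule: finite_induct)
  case empty
  then show ?case by (simp add: inv_expansion_def)
next
  case (insert i I)
  then show ?case by (simp add: inv_expansion_add)
qed

lemma inv_expansion_cong:
  assumes "\<forall>\<^sub>F n in sequentially. x n = y n" "inv_expansion K x p"
  shows "inv_expansion K y p"
proof -
  have "\<forall>\<^sub>F n in sequentially. x n - poly p (1 / of_nat n) = y n - poly p (1 / of_nat n)"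
    using assms(1) by eventually_elim simp
  from landau_o.big.in_cong[OF this] show ?thesis
    using assms(2) unfolding inv_expansion_def by blast
qed

lemma inv_expansion_tendsto:
  assumes "inv_expansion K x p" "K \<ge> 1"
  shows "x \<longlonglongrightarrow> coeff p 0"
proof -
  have "(\<lambda>n. x n - poly p (1 / of_nat n)) \<in> O(\<lambda>n. 1 / of_nat n)"
    using inv_expansion_mono[OF assms] by (simp add: inv_expansion_def)
  moreover have "(\<lambda>n. 1 / of_nat n :: complex) \<in> o(\<lambda>_. 1)"
    using lim_1_over_n by (intro smalloI_tendsto) auto
  ultimately have "(\<lambda>n. x n - poly p (1 / of_nat n)) \<in> o(\<lambda>_. 1)"
    by (blast intro: landau_o.big_small_trans)
  then have "(\<lambda>n. x n - poly p (1 / of_nat n)) \<longlonglongrightarrow> 0"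
    by (auto dest: smalloD_tendsto)
  from tendsto_add[OF this poly_inverse_tendsto[of p]] show ?thesis by simp
qed

text \<open>The constant term is the limit of the values. Once it vanishes, multiplying by
  \<open>n\<close> strips a factor \<open>1 / n\<close> and lowers \<open>K\<close> by one, so that
  the next coefficient becomes the constant term.\<close>

lemma poly_inverse_bigo_coeff_eq_0:
  assumes "(\<lambda>n. poly p (1 / of_nat n :: complex)) \<in> O(\<lambda>n. 1 / of_nat n ^ K)" "l < K"
  shows "coeff p l = 0"
  using assms
proof (induction l arbitrary: p K)
  case 0
  have "inv_expansion K (\<lambda>n. poly p (1 / of_nat n)) 0"
    using 0 by (intro inv_expansion_bigo_0)
  from inv_expansion_tendsto[OF this] 0 have "(\<lambda>n. poly p (1 / of_nat n)) \<longlonglongrightarrow> 0"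
    by simp
  with poly_inverse_tendsto[of p] show ?case
    by (rule LIMSEQ_unique)
next
  case (Suc l)
  from Suc.prems(2) obtain K' where K: "K = Suc K'" by (cases K) auto
  have "inv_expansion K (\<lambda>n. poly p (1 / of_nat n)) 0"
    using Suc.prems by (intro inv_expansion_bigo_0)
  from inv_expansion_tendsto[OF this] Suc.prems have "(\<lambda>n. poly p (1 / of_nat n)) \<longlonglongrightarrow> 0"
    by simp
  with poly_inverse_tendsto[of p] have p0: "coeff p 0 = 0"
    by (rule LIMSEQ_unique)
  obtain c q where p: "p = pCons c q" by (cases p) 
  with p0 have "c = 0" by simp
  with p have p: "p = pCons 0 q" by simp
  have "(\<lambda>n. of_nat n * poly p (1 / of_nat n :: complex)) \<in> O(\<lambda>n. of_nat n * (1 / of_nat n ^ K))"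
    by (intro landau_o.big.mult Suc.prems) auto
  also have "?this \<longleftrightarrow> (\<lambda>n. poly q (1 / of_nat n :: complex)) \<in> O(\<lambda>n. 1 / of_nat n ^ K')"
    by (intro landau_o.big.cong_ex eventually_mono[OF eventually_gt_at_top[of 0]])
       (auto simp: p K)
  finally have "coeff q l = 0"
    using Suc.prems(2) K by (intro Suc.IH[of q K']) auto
  then show ?case by (simp add: p)
qed

lemma inv_expansion_unique:
  assumes "inv_expansion K x p" "inv_expansion L x q" "l < K" "l < L"
  shows "coeff p l = coeff q l"
proof -
  have "inv_expansion (Suc l) x p" "inv_expansion (Suc l) x q"
    using assms by (auto intro: inv_expansion_mono)
  then have "(\<lambda>n. poly (q - p) (1 / of_nat n :: complex)) \<in> O(\<lambda>n. 1 / of_nat n ^ Suc l)"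
    unfolding inv_expansion_def by (auto dest: sum_in_bigo(2))
  from poly_inverse_bigo_coeff_eq_0[OF this, of l] show ?thesis by simp
qed

section \<open>Taylor expansion at 0 with an analytic remainder\<close>

text \<open>The singularity of \<open>(r z - r 0) / z\<close> at 0 is removable. The identity holds
  for every \<open>z\<close>, even where \<open>r\<close> is not analytic, since away from 0 it is
  pure algebra; later substitutions therefore carry no side condition.\<close>

lemma analytic_difference_quotient:
  assumes "r analytic_on {0 :: complex}"
  obtains q where "q analytic_on {0}" "\<And>z. r z = r 0 + z * q z" "q 0 = deriv r 0"
proof
  let ?q = "\<lambda>z. if z = 0 then deriv r 0 else (r z - r 0) / z"
  from assms obtain S where S: "open S" "0 \<in> S" "r holomorphic_on S"
    unfolding analytic_at by blast
  have "?q holomorphic_on S"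
    using pole_lemma_open[OF S(3,1), of 0] by (simp cong: if_cong)
  with S show "?q analytic_on {0}"
    unfolding analytic_at by blast
qed auto

text \<open>Two difference quotients in a row. The value \<open>q 0\<close> comes from the product
  rule for \<open>r 0 + z * r1 z\<close> on a whole neighbourhood of 0, which makes the second
  derivative of \<open>r\<close> at 0 equal to \<open>2 * deriv r1 0\<close>.\<close>

lemma analytic_second_quotient:
  assumes "r analytic_on {0 :: complex}"
  obtains q where "q analytic_on {0}" "\<And>z. r z = r 0 + z * deriv r 0 + z ^ 2 * q z"
    "q 0 = deriv (deriv r) 0 / 2"
proof -
  obtain r1 where r1: "r1 analytic_on {0}" "\<And>z. r z = r 0 + z * r1 z" "r1 0 = deriv r 0"
    using analytic_difference_quotient[OF assms] by blast
  obtain q where q: "q analytic_on {0}" "\<And>z. r1 z = r1 0 + z * q z" "q 0 = deriv r1 0"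
    using analytic_difference_quotient[OF r1(1)] by blast
  have eq: "r z = r 0 + z * deriv r 0 + z ^ 2 * q z" for z
    using r1(2)[of z] r1(3) unfolding q(2)[of z] by (simp add: power2_eq_square algebra_simps)
  obtain S where S: "open S" "0 \<in> S" "r1 holomorphic_on S"
    using r1(1) unfolding analytic_at by blast
  have d: "deriv r z = r1 z + z * deriv r1 z" if "z \<in> S" for z
  proof (rule DERIV_imp_deriv)
    have "(r1 has_field_derivative deriv r1 z) (at z)"
      using S that by (intro holomorphic_derivI) auto
    then have "((\<lambda>z. r 0 + z * r1 z) has_field_derivative r1 z + z * deriv r1 z) (at z)"
      by (auto intro!: derivative_eq_intros)
    moreover have "r = (\<lambda>z. r 0 + z * r1 z)"
      using r1(2) by (intro ext)
    ultimately show "(r has_field_derivative r1 z + z * deriv r1 z) (at z)"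
      by simp
  qed
  have "((\<lambda>z. r1 z + z * deriv r1 z) has_field_derivative deriv r1 0 + deriv r1 0) (at 0)"
  proof -
    have "(r1 has_field_derivative deriv r1 0) (at 0)" "(deriv r1 has_field_derivative deriv (deriv r1) 0) (at 0)"
      using S by (auto intro!: holomorphic_derivI holomorphic_deriv)
    then show ?thesis by (auto intro!: derivative_eq_intros)
  qed
  then have "(deriv r has_field_derivative deriv r1 0 + deriv r1 0) (at 0)"
    by (rule has_field_derivative_transform_within_open[OF _ S(1,2)]) (use d in auto)
  then have "q 0 = deriv (deriv r) 0 / 2"
    using q(3) by (simp add: DERIV_imp_deriv)
  with q(1) eq that show thesis by blast
qed

text \<open>Iterated difference quotients. The coefficient of degree 1 is recorded because it
  determines the leading constant of the final expansion.\<close>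

lemma analytic_taylor:
  assumes "r analytic_on {0 :: complex}"
  obtains p q where "q analytic_on {0}" "\<And>z. r z = poly p z + z ^ K * q z"
    "K > 0 \<Longrightarrow> coeff p 0 = r 0" "K > 1 \<Longrightarrow> coeff p 1 = deriv r 0"
proof -
  have "\<exists>p q. q analytic_on {0} \<and> (\<forall>z. r z = poly p z + z ^ K * q z) \<and>
      (K > 0 \<longrightarrow> coeff p 0 = r 0) \<and> (K > 1 \<longrightarrow> coeff p 1 = deriv r 0)"
    using assms
  proof (induction K arbitrary: r)
    case 0
    then show ?case by (intro exI[of _ 0] exI[of _ r]) auto
  next
    case (Suc K)
    obtain r' where r': "r' analytic_on {0}" "\<And>z. r z = r 0 + z * r' z" "r' 0 = deriv r 0"
      using analytic_difference_quotient[OF Suc.prems] by blast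
    obtain p q where pq: "q analytic_on {0}" "\<forall>z. r' z = poly p z + z ^ K * q z"
        "K > 0 \<longrightarrow> coeff p 0 = r' 0"
      using Suc.IH[OF r'(1)] by blast
    have eq: "r z = poly (pCons (r 0) p) z + z ^ Suc K * q z" for z
      using r'(2)[of z] pq(2)[rule_format, of z] by (simp add: algebra_simps)
    show ?case
    proof (intro exI[of _ "pCons (r 0) p"] exI[of _ q] conjI allI impI)
      show "coeff (pCons (r 0) p) 1 = deriv r 0" if "Suc K > 1"
        using that pq(3) r'(3) by simp
    qed (auto intro: pq(1) eq simp del: poly_pCons power_Suc)
  qed
  with that show thesis by blast
qed

lemma analytic_at_inverse_bigo:
  assumes "q analytic_on {0 :: complex}"
  shows "(\<lambda>n. q (1 / of_nat n)) \<in> O(\<lambda>_. 1)"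
proof (rule bigoI_tendsto[where c = "q 0"])
  have "(\<lambda>n. 1 / of_nat n :: complex) \<longlonglongrightarrow> 0"
    by (rule lim_1_over_n)
  then have "(\<lambda>n. q (1 / of_nat n)) \<longlonglongrightarrow> q 0"
    by (rule isCont_tendsto_compose[rotated]) (use assms in \<open>rule analytic_at_imp_isCont\<close>)
  then show "(\<lambda>n. q (1 / of_nat n) / 1) \<longlonglongrightarrow> q 0"
    by simp
qed auto

lemma inv_expansion_analytic:
  assumes "r analytic_on {0 :: complex}"
  obtains p where "inv_expansion K (\<lambda>n. r (1 / of_nat n)) p"
proof -
  obtain p q where pq: "q analytic_on {0}" "\<And>z. r z = poly p z + z ^ K * q z"
    using analytic_taylor[OF assms, of K] by blast
  have "(\<lambda>n. (1 / of_nat n) ^ K * q (1 / of_nat n)) \<in> O(\<lambda>n. (1 / of_nat n) ^ K * 1)"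
    by (intro landau_o.big.mult analytic_at_inverse_bigo pq) auto
  then have "inv_expansion K (\<lambda>n. r (1 / of_nat n)) p"
    by (simp add: inv_expansion_def pq(2) power_divide)
  with that show thesis by blast
qed

section \<open>Discrete integration: from differences to the sequence\<close>

text \<open>Comparison of the tail sum of the differences with a telescoping majorant, the discrete
  form of integrating \<open>1 / n ^ (K + 2)\<close>.\<close>

lemma limit_bigo_of_difference_bigo:
  fixes x :: "nat \<Rightarrow> complex"
  assumes lim: "x \<longlonglongrightarrow> \<kappa>"
    and diff: "(\<lambda>n. x (Suc n) - x n) \<in> O(\<lambda>n. 1 / of_nat n ^ (K + 2))"
  shows "(\<lambda>n. x n - \<kappa>) \<in> O(\<lambda>n. 1 / of_nat n ^ (K + 1))"
proof -
  from diff obtain c where c: "c > 0"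
    "\<forall>\<^sub>F n in sequentially. norm (x (Suc n) - x n) \<le> c * norm (1 / of_nat n ^ (K + 2) :: complex)"
    by (elim landau_o.bigE)
  then obtain N where N: "\<And>n. n \<ge> N \<Longrightarrow> norm (x (Suc n) - x n) \<le> c / real n ^ (K + 2)"
    by (auto simp: eventually_sequentially norm_divide norm_power norm_mult)
  \<comment> \<open>The factor \<open>2 ^ (K + 1)\<close> bounds
    \<open>(1 + 1 / n) ^ (K + 1)\<close> and makes \<open>t n - t (Suc n)\<close> at least
    \<open>c / n ^ (K + 2)\<close>.\<close>
  define t where "t = (\<lambda>n. c * 2 ^ (K + 1) / real n ^ (K + 1))"
  have step: "norm (x (Suc n) - x n) \<le> t n - t (Suc n)" if n: "n \<ge> max 1 N" for n
  proof -
    define s where "s = 1 / real n"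
    have n0: "real n > 0" using n by simp
    have s: "0 < s" "s \<le> 1" using n by (auto simp: s_def)
    have a: "1 + s \<le> (1 + s) ^ (K + 1)"
      using s power_increasing[of 1 "K+1" "1 + s"] by simp
    have b: "(1 + s) ^ (K + 1) \<le> 2 ^ (K + 1)"
      using s by (intro power_mono) auto
    have "s / 2 ^ (K + 1) \<le> ((1 + s) ^ (K + 1) - 1) / (1 + s) ^ (K + 1)"
      by (intro frac_le) (use a b s in linarith)+
    also have "\<dots> = 1 - 1 / (1 + s) ^ (K + 1)"
      using s by (simp add: diff_divide_distrib)
    finally have *: "s \<le> 2 ^ (K + 1) * (1 - 1 / (1 + s) ^ (K + 1))"
      by (subst (asm) pos_divide_le_eq) (simp_all only: mult.commute zero_less_power zero_less_numeral)
    have scale: "c * B / P - c * B / (P * Q) = c / P * (B * (1 - 1 / Q))" for B P Q :: real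
      by (simp add: algebra_simps)
    have "real (Suc n) = real n * (1 + s)"
      using n0 by (simp add: s_def field_simps)
    then have "t n - t (Suc n) = c / real n ^ (K + 1) * (2 ^ (K + 1) * (1 - 1 / (1 + s) ^ (K + 1)))"
      by (simp only: t_def power_mult_distrib scale)
    also have "\<dots> \<ge> c / real n ^ (K + 1) * s"
      using * c(1) n0 by (intro mult_left_mono) auto
    also have "c / real n ^ (K + 1) * s = c / real n ^ (K + 2)"
      by (simp add: s_def)
    finally show ?thesis using N[of n] n by auto
  qed
  have tel: "norm (x (n + m) - x n) \<le> t n - t (n + m)" if n: "n \<ge> max 1 N" for n m
  proof (induction m)
    case (Suc m)
    have "norm (x (n + Suc m) - x n) \<le> norm (x (Suc (n + m)) - x (n + m)) + norm (x (n + m) - x n)"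
      using norm_triangle_ineq[of "x (Suc (n + m)) - x (n + m)" "x (n + m) - x n"] by simp
    with Suc step[of "n + m"] n show ?case by simp
  qed auto
  have bound: "norm (x n - \<kappa>) \<le> t n" if n: "n \<ge> max 1 N" for n
  proof -
    have "norm (x (n + m) - x n) \<le> t n" for m
    proof -
      have "t (n + m) \<ge> 0" using c by (simp add: t_def)
      with tel[OF n, of m] show ?thesis by simp
    qed
    moreover have "(\<lambda>m. norm (x (n + m) - x n)) \<longlonglongrightarrow> norm (\<kappa> - x n)"
      using LIMSEQ_ignore_initial_segment[OF lim, of n]
      by (intro tendsto_intros) (simp add: add.commute)
    ultimately have "norm (\<kappa> - x n) \<le> t n"
      by (intro LIMSEQ_le_const2) auto
    then show ?thesis by (simp add: norm_minus_commute)
  qed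
  show ?thesis
  proof (rule bigoI)
    show "\<forall>\<^sub>F n in sequentially. norm (x n - \<kappa>) \<le> (c * 2 ^ (K + 1)) * norm (1 / of_nat n ^ (K + 1) :: complex)"
      using eventually_ge_at_top[of "max 1 N"]
      by eventually_elim (use bound in \<open>auto simp: t_def norm_divide norm_power norm_mult\<close>)
  qed
qed

text \<open>Downward induction from \<open>m = K\<close>, where the differences are already within
  the error and the limit alone is a sufficient expansion. For smaller \<open>m\<close>, adding a
  multiple of \<open>1 / n ^ (m + 1)\<close> to the sequence removes the leading term of its
  differences and raises \<open>m\<close> by one.\<close>

lemma inv_expansion_of_differences_aux:
  fixes x :: "nat \<Rightarrow> complex"
  assumes "x \<longlonglongrightarrow> \<kappa>"
    and "(\<lambda>n. x (Suc n) - x n - (1 / of_nat n) ^ (m + 2) * poly p (1 / of_nat n)) \<in> O(\<lambda>n. 1 / of_nat n ^ (K + 2))"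
    and "m \<le> K"
  shows "\<exists>q. inv_expansion (Suc K) x q"
  using assms(3,1,2)
proof (induction m arbitrary: x p rule: inc_induct)
  case base
  have "(\<lambda>n. (1 / of_nat n) ^ (K + 2) * poly p (1 / of_nat n)) \<in> O(\<lambda>n. (1 / of_nat n) ^ (K + 2) * 1)"
    by (intro landau_o.big.mult poly_inverse_bigo) auto
  then have "(\<lambda>n. (1 / of_nat n) ^ (K + 2) * poly p (1 / of_nat n)) \<in> O(\<lambda>n. 1 / of_nat n ^ (K + 2))"
    by (simp add: power_divide del: power_Suc)
  from sum_in_bigo(1)[OF base(2) this] have "(\<lambda>n. x (Suc n) - x n) \<in> O(\<lambda>n. 1 / of_nat n ^ (K + 2))"
    by simp
  from limit_bigo_of_difference_bigo[OF base(1) this] have "inv_expansion (Suc K) x [:\<kappa>:]"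
    by (simp add: inv_expansion_def)
  then show ?case by blast
next
  case (step m)
  obtain e p' where p: "p = pCons e p'" by (cases p)
  \<comment> \<open>The difference of \<open>1 / n ^ (m + 1)\<close> begins with
    \<open>- (m + 1) / n ^ (m + 2)\<close>, so this multiple cancels the leading coefficient
    \<open>e\<close>.\<close>
  define b where "b = e / of_nat (m + 1)"
  have e: "e = b * of_nat (m + 1)"
    by (simp add: b_def del: of_nat_Suc of_nat_add)
  \<comment> \<open>With \<open>X = 1 / n\<close> one has \<open>1 / (n + 1) = X / (1 + X)\<close>;
    thus \<open>h X\<close> is the factor by which \<open>1 / n ^ (m + 1)\<close> changes when
    \<open>n\<close> is replaced by \<open>n + 1\<close>.\<close>
  define h :: "complex \<Rightarrow> complex" where "h = (\<lambda>X. 1 / (1 + X) ^ (m + 1))"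
  have h_deriv: "(h has_field_derivative - of_nat (m + 1)) (at 0)"
    unfolding h_def by (auto intro!: derivative_eq_intros simp: divide_simps)
  have h_an: "h analytic_on {0}"
    unfolding h_def by (intro analytic_intros) auto
  obtain r where r: "r analytic_on {0}" "\<And>z. h z = h 0 + z * deriv h 0 + z ^ 2 * r z"
    using analytic_second_quotient[OF h_an] by blast
  have "h 0 = 1" "deriv h 0 = - of_nat (m + 1)"
    using DERIV_imp_deriv[OF h_deriv] by (simp_all add: h_def)
  then have h_eq: "h z = 1 - of_nat (m + 1) * z + z ^ 2 * r z" for z
    using r(2)[of z] by (simp only: mult.commute mult_minus_right uminus_add_conv_diff diff_conv_add_uminus)
  obtain q where q: "inv_expansion K (\<lambda>n. r (1 / of_nat n)) q"
    using inv_expansion_analytic[OF r(1)] by blast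
  define y where "y = (\<lambda>n. x n + b * (1 / of_nat n) ^ (m + 1))"
  have "(\<lambda>n. (1 / of_nat n) ^ (m + 1) :: complex) \<longlonglongrightarrow> 0 ^ (m + 1)"
    by (intro tendsto_power lim_1_over_n)
  then have "y \<longlonglongrightarrow> \<kappa> + b * 0 ^ (m + 1)"
    unfolding y_def by (intro tendsto_intros step.prems)
  then have y_lim: "y \<longlonglongrightarrow> \<kappa>" by simp
  have "(\<lambda>n. (1 / of_nat n) ^ (m + 3) * (r (1 / of_nat n) - poly q (1 / of_nat n))) \<in> O(\<lambda>n. 1 / of_nat n ^ (m + 3) * (1 / of_nat n ^ K))"
    using q by (intro landau_o.big.mult) (auto simp: inv_expansion_def power_divide)
  also have "(\<lambda>n. 1 / of_nat n ^ (m + 3) * (1 / of_nat n ^ K) :: complex) = (\<lambda>n. 1 / of_nat n ^ (m + 3 + K))"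
    by (simp add: power_add)
  also have "\<dots> \<in> O(\<lambda>n. 1 / of_nat n ^ (K + 2))"
    by (intro inverse_power_bigo_mono) auto
  finally have "(\<lambda>n. b * ((1 / of_nat n) ^ (m + 3) * (r (1 / of_nat n) - poly q (1 / of_nat n)))) \<in> O(\<lambda>n. 1 / of_nat n ^ (K + 2))"
    by (cases "b = 0") auto
  from sum_in_bigo(1)[OF step.prems(2) this]
  have "(\<lambda>n. (x (Suc n) - x n - (1 / of_nat n) ^ (m + 2) * poly p (1 / of_nat n)) +
      b * ((1 / of_nat n) ^ (m + 3) * (r (1 / of_nat n) - poly q (1 / of_nat n)))) \<in> O(\<lambda>n. 1 / of_nat n ^ (K + 2))" .
  also have "?this \<longleftrightarrow> (\<lambda>n. y (Suc n) - y n - (1 / of_nat n) ^ (Suc m + 2) * poly (p' + smult b q) (1 / of_nat n))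
      \<in> O(\<lambda>n. 1 / of_nat n ^ (K + 2))"
  proof (intro landau_o.big.cong_ex eventually_mono[OF eventually_gt_at_top[of 0]] refl)
    fix n :: nat assume n: "n > 0"
    define X where "X = 1 / (of_nat n :: complex)"
    have "1 / of_nat (Suc n) = X / (1 + X)"
      using n by (simp add: X_def divide_simps add.commute)
    then have hX: "(1 / of_nat (Suc n)) ^ (m + 1) = X ^ (m + 1) * h X"
      by (simp only: h_def power_divide times_divide_eq_right mult_1_right)
    have "x (Suc n) + b * (P * H) - (x n + b * P) = x (Suc n) - x n + b * P * (H - 1)" for P H
      by (simp add: algebra_simps)
    then have "y (Suc n) - y n = x (Suc n) - x n + b * X ^ (m + 1) * (h X - 1)"
      by (simp only: y_def hX X_def [symmetric])
    also have "\<dots> = x (Suc n) - x n + b * X ^ (m + 1) * (X ^ 2 * r X - of_nat (m + 1) * X)"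
      by (simp add: h_eq)
    finally have yd: "y (Suc n) - y n = \<dots>" .
    have "(x (Suc n) - x n - X ^ (m + 2) * poly p X) + b * (X ^ (m + 3) * (r X - poly q X)) =
      y (Suc n) - y n - X ^ (Suc m + 2) * poly (p' + smult b q) X"
      unfolding yd p e by (simp add: algebra_simps power2_eq_square numeral_3_eq_3)
    then show "(x (Suc n) - x n - (1 / of_nat n) ^ (m + 2) * poly p (1 / of_nat n)) +
      b * ((1 / of_nat n) ^ (m + 3) * (r (1 / of_nat n) - poly q (1 / of_nat n))) =
      y (Suc n) - y n - (1 / of_nat n) ^ (Suc m + 2) * poly (p' + smult b q) (1 / of_nat n)"
      by (simp only: X_def)
  qed
  finally obtain q' where "inv_expansion (Suc K) y q'"
    using step.IH[OF y_lim] by blast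
  from inv_expansion_add[OF this inv_expansion_poly[of _ "monom (-b) (m + 1)"]]
  have "inv_expansion (Suc K) x (q' + monom (-b) (m + 1))"
    by (simp add: y_def poly_monom)
  then show ?case by blast
qed

lemma inv_expansion_of_differences:
  fixes x :: "nat \<Rightarrow> complex"
  assumes "x \<longlonglongrightarrow> \<kappa>" "inv_expansion K y p" 
    and "\<forall>\<^sub>F n in sequentially. x (Suc n) - x n = (1 / of_nat n) ^ 2 * y n"
  obtains q where "inv_expansion (Suc K) x q"
proof -
  have "(\<lambda>n. (1 / of_nat n) ^ 2 * (y n - poly p (1 / of_nat n))) \<in> O(\<lambda>n. (1 / of_nat n) ^ 2 * (1 / of_nat n ^ K))"
    using assms(2) by (intro landau_o.big.mult) (auto simp: inv_expansion_def)
  also have "?this \<longleftrightarrow> (\<lambda>n. x (Suc n) - x n - (1 / of_nat n) ^ (0 + 2) * poly p (1 / of_nat n)) \<in> O(\<lambda>n. 1 / of_nat n ^ (K + 2))"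
    using assms(3)
    by (intro landau_o.big.cong_ex) (auto elim!: eventually_mono simp: algebra_simps power_divide power2_eq_square)
  finally show thesis
    using inv_expansion_of_differences_aux[OF assms(1), of 0 p K] that by auto
qed

text \<open>
  For \<open>x = 1 / n\<close> the ratio of consecutive terms is \<open>(1 - \<alpha> x) (1 + x) powr \<alpha> = 1 + O(x\<^sup>2)\<close>,
  so an expansion of order \<open>K\<close> for the sequence gives one of order \<open>K + 2\<close> for its differences,
  and hence one of order \<open>K + 1\<close> for the sequence itself.
\<close>

lemma gbinomial_inv_expansion:
  fixes \<alpha> :: complex
  defines "L \<equiv> (\<lambda>n. (-1) ^ n * (\<alpha> gchoose n) * exp ((\<alpha> + 1) * of_real (ln (real n))))"
  obtains p where "inv_expansion K L p" "K \<ge> 1 \<Longrightarrow> coeff p 0 = inverse (Gamma (- \<alpha>))"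
proof -
  have L_lim: "L \<longlonglongrightarrow> inverse (Gamma (- \<alpha>))"
  proof (rule Lim_transform_eventually[OF gbinomial_asymptotic])
    show "\<forall>\<^sub>F n in sequentially. (\<alpha> gchoose n) / ((-1) ^ n / exp ((\<alpha> + 1) * of_real (ln (real n)))) = L n"
      by (intro always_eventually allI) (simp add: L_def field_simps flip: power_mult_distrib)
  qed
  define \<rho> where "\<rho> = (\<lambda>X. (1 - \<alpha> * X) * exp (\<alpha> * Ln (1 + X)))"
  have \<rho>_deriv: "(\<rho> has_field_derivative 0) (at 0)"
    unfolding \<rho>_def by (auto intro!: derivative_eq_intros)
  have "\<rho> analytic_on {0}"
    unfolding \<rho>_def by (intro analytic_intros) auto
  then obtain r where r: "r analytic_on {0}" "\<And>z. \<rho> z = \<rho> 0 + z * deriv \<rho> 0 + z ^ 2 * r z"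
    using analytic_second_quotient by blast
  have "\<rho> 0 = 1" "deriv \<rho> 0 = 0"
    using DERIV_imp_deriv[OF \<rho>_deriv] by (simp_all add: \<rho>_def)
  then have \<rho>_eq: "\<rho> z = 1 + z ^ 2 * r z" for z
    using r(2)[of z] by simp
  have L_Suc: "L (Suc n) = \<rho> (1 / of_nat n) * L n" if n: "n > 0" for n
  proof -
    have "of_nat (Suc n) * (\<alpha> gchoose Suc n) = (\<alpha> - of_nat n) * (\<alpha> gchoose n)"
      using gbinomial_mult_1[of \<alpha> n] by (simp add: algebra_simps)
    then have 1: "\<alpha> gchoose Suc n = (\<alpha> - of_nat n) / of_nat (Suc n) * (\<alpha> gchoose n)"
      by (simp add: field_simps del: of_nat_Suc)
    have "real (Suc n) = real n * (1 + 1 / real n)"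
      using n by (simp add: field_simps)
    then have "ln (real (Suc n)) = ln (real n) + ln (1 + 1 / real n)"
      using n by (simp only: ln_mult_pos add_pos_pos divide_pos_pos of_nat_0_less_iff zero_less_one)
    moreover have "of_real (ln (1 + 1 / real n)) = Ln (1 + 1 / of_nat n)"
      using n by (subst Ln_of_real[symmetric]) (auto simp: add_pos_pos)
    ultimately have 2: "exp ((\<alpha> + 1) * of_real (ln (real (Suc n)))) =
        exp ((\<alpha> + 1) * of_real (ln (real n))) * (exp (\<alpha> * Ln (1 + 1 / of_nat n)) * exp (Ln (1 + 1 / of_nat n)))"
      by (simp add: algebra_simps exp_add)
    have "1 + 1 / complex_of_nat n = of_nat (Suc n) / of_nat n"
      using n by (simp add: field_simps)
    then have 3: "exp (Ln (1 + 1 / complex_of_nat n)) = of_nat (Suc n) / of_nat n"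
      using n by (subst exp_Ln) (auto simp del: of_nat_Suc)
    \<comment> \<open>The factor \<open>(n + 1) / n\<close> stemming from the \<open>+ 1\<close> in
      the exponent cancels the denominator of the binomial recurrence.\<close>
    have 4: "- ((\<alpha> - of_nat n) / of_nat (Suc n)) * (of_nat (Suc n) / of_nat n) = 1 - \<alpha> * (1 / of_nat n)"
      using n by (simp add: divide_simps del: of_nat_Suc)
    have "L (Suc n) = (-1) ^ n * (\<alpha> gchoose n) * exp ((\<alpha> + 1) * of_real (ln (real n))) *
      exp (\<alpha> * Ln (1 + 1 / of_nat n)) * (- ((\<alpha> - of_nat n) / of_nat (Suc n)) * (of_nat (Suc n) / of_nat n))"
      unfolding L_def 1 2 3 by (simp only: power_Suc mult_ac minus_mult_left [symmetric] mult_1_left mult_minus_right)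
    then show ?thesis
      unfolding 4 by (simp add: L_def \<rho>_def mult_ac)
  qed
  have "\<exists>p. inv_expansion K L p"
  proof (induction K)
    case 0
    have "L \<in> O(\<lambda>_. 1)"
      using L_lim by (intro bigoI_tendsto[where c = "inverse (Gamma (- \<alpha>))"]) auto
    then show ?case
      by (intro exI[of _ 0] inv_expansion_bigo_0) simp
  next
    case (Suc K)
    then obtain p where p: "inv_expansion K L p" by blast
    obtain q where "inv_expansion K (\<lambda>n. r (1 / of_nat n)) q"
      using inv_expansion_analytic[OF r(1)] by blast
    from inv_expansion_mult[OF this p]
    have *: "inv_expansion K (\<lambda>n. r (1 / of_nat n) * L n) (q * p)" .
    have "\<forall>\<^sub>F n in sequentially. L (Suc n) - L n = (1 / of_nat n) ^ 2 * (r (1 / of_nat n) * L n)"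
      using eventually_gt_at_top[of 0] by eventually_elim (simp add: L_Suc \<rho>_eq algebra_simps)
    from inv_expansion_of_differences[OF L_lim * this] show ?case by blast
  qed
  then obtain p where p: "inv_expansion K L p" by blast
  moreover have "coeff p 0 = inverse (Gamma (- \<alpha>))" if "K \<ge> 1"
    using inv_expansion_tendsto[OF p that] L_lim by (rule LIMSEQ_unique)
  ultimately show thesis by (rule that)
qed

section \<open>Coefficients of functions with a square root singularity\<close>

lemma compact_locally_bounded_imp_bounded:
  assumes "compact K" "D \<subseteq> K"
    and "\<And>\<zeta>. \<zeta> \<in> K \<Longrightarrow> \<exists>T. open T \<and> \<zeta> \<in> T \<and> bounded (h ` (T \<inter> D))"
  shows "bounded (h ` D)"
proof -
  from assms(3) obtain T where T: "\<And>\<zeta>. \<zeta> \<in> K \<Longrightarrow> open (T \<zeta>) \<and> \<zeta> \<in> T \<zeta> \<and> bounded (h ` (T \<zeta> \<inter> D))"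
    by metis
  obtain F where F: "F \<subseteq> K" "finite F" "K \<subseteq> (\<Union>\<zeta>\<in>F. T \<zeta>)"
    using compactE_image[OF assms(1), of K T] T by blast
  have "bounded (\<Union>\<zeta>\<in>F. h ` (T \<zeta> \<inter> D))"
    using F T by (intro bounded_UN) auto
  moreover have "h ` D \<subseteq> (\<Union>\<zeta>\<in>F. h ` (T \<zeta> \<inter> D))"
    using F assms(2) by blast
  ultimately show ?thesis by (rule bounded_subset)
qed

text \<open>The coefficient with index \<open>n = k + M\<close> is, up to \<open>n!\<close>, the
  \<open>k\<close>-th derivative at 0 of the bounded function \<open>(deriv ^^ M) f\<close>.
  Cauchy's inequality leaves the factor \<open>k! / n!\<close>, and
  \<open>n! / k! = M! * (n choose M)\<close> is at least \<open>(n / M) ^ M\<close>.\<close>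

lemma fps_nth_bigo_bounded_higher_deriv:
  fixes f :: "complex \<Rightarrow> complex"
  assumes hol: "f holomorphic_on ball 0 R" and R: "R > 0"
    and a: "f has_fps_expansion a"
    and bd: "bounded ((deriv ^^ M) f ` ball 0 R)"
  shows "(\<lambda>n. fps_nth a n * of_real R ^ n) \<in> O(\<lambda>n. 1 / of_nat n ^ M)"
proof -
  from bd obtain B where B: "\<And>z. z \<in> ball 0 R \<Longrightarrow> norm ((deriv ^^ M) f z) \<le> B"
    unfolding bounded_iff by blast
  have holM: "(deriv ^^ M) f holomorphic_on ball 0 R"
    using hol by (intro holomorphic_higher_deriv) auto
  have main: "norm (fps_nth a (k + M)) * fact (k + M) * R ^ k \<le> fact k * B" for k
  proof -
    \<comment> \<open>The bound is known on the open disc only, so Cauchy's inequality is applied on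
      circles of radius \<open>r < R\<close>, and \<open>r\<close> tends to \<open>R\<close>
      afterwards.\<close>
    have *: "norm (fps_nth a (k + M)) * fact (k + M) * r ^ k \<le> fact k * B" if r: "0 < r" "r < R" for r
    proof -
      have "norm ((deriv ^^ k) ((deriv ^^ M) f) 0) \<le> fact k * B / r ^ k"
      proof (rule Cauchy_inequality)
        show "(deriv ^^ M) f holomorphic_on ball 0 r"
          using r by (intro holomorphic_on_subset[OF holM]) auto
        show "continuous_on (cball 0 r) ((deriv ^^ M) f)"
          using r by (intro holomorphic_on_imp_continuous_on holomorphic_on_subset[OF holM]) auto
        show "norm ((deriv ^^ M) f x) \<le> B" if "norm (0 - x) = r" for x
          using that r by (intro B) auto
      qed (use r in auto)
      moreover have "(deriv ^^ k) ((deriv ^^ M) f) 0 = fact (k + M) * fps_nth a (k + M)"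
        using fps_nth_fps_expansion[OF a, of "k + M"] by (simp add: funpow_add)
      ultimately show ?thesis
        using r by (simp add: norm_mult field_simps)
    qed
    have "((\<lambda>r. norm (fps_nth a (k + M)) * fact (k + M) * r ^ k) \<longlongrightarrow> norm (fps_nth a (k + M)) * fact (k + M) * R ^ k) (at_left R)"
      by (intro tendsto_intros)
    moreover have "\<forall>\<^sub>F r in at_left R. norm (fps_nth a (k + M)) * fact (k + M) * r ^ k \<le> fact k * B"
      using eventually_at_left_real[OF R] by eventually_elim (use * in auto)
    ultimately show ?thesis
      by (rule tendsto_upperbound) auto
  qed
  show ?thesis
  proof (rule bigoI)
    show "\<forall>\<^sub>F n in sequentially. norm (fps_nth a n * of_real R ^ n) \<le> (B * R ^ M * of_nat M ^ M) * norm (1 / of_nat n ^ M :: complex)"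
      using eventually_ge_at_top[of "Suc M"]
    proof eventually_elim
      case (elim n)
      define k where "k = n - M"
      have n: "n = k + M" "n > 0" using elim by (auto simp: k_def)
      have ch: "(real n / real M) ^ M \<le> real (n choose M)"
        using elim by (intro binomial_ge_n_over_k_pow_k) auto
      have f: "(fact n :: real) = fact k * (fact M * real (n choose M))"
      proof -
        have "fact M * fact k * (n choose M) = fact n"
          using binomial_fact_lemma[of M n] elim by (simp add: k_def)
        then have "real (fact n) = real (fact M * fact k * (n choose M))"
          by simp
        then show ?thesis by simp
      qed
      have "norm (fps_nth a n) * fact n * R ^ k \<le> fact k * B"
        using main[of k] n by simp
      then have "fact k * (norm (fps_nth a n) * (fact M * real (n choose M)) * R ^ k) \<le> fact k * B"
        unfolding f by (simp add: mult_ac)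
      then have 1: "norm (fps_nth a n) * (fact M * real (n choose M)) * R ^ k \<le> B"
        by (simp only: mult_le_cancel_left_pos fact_gt_zero)
      have "(real n / real M) ^ M \<le> fact M * real (n choose M)"
        using ch mult_right_mono[of 1 "fact M" "real (n choose M)"] fact_ge_1[of M, where 'a = real] by simp
      then have "norm (fps_nth a n) * (real n / real M) ^ M * R ^ k \<le> norm (fps_nth a n) * (fact M * real (n choose M)) * R ^ k"
        using R by (intro mult_right_mono mult_left_mono) auto
      with 1 have 2: "norm (fps_nth a n) * (real n / real M) ^ M * R ^ k \<le> B"
        by linarith
      have p1: "R ^ n = R ^ k * R ^ M"
        by (simp add: n(1) power_add)
      have p2: "(real n / real M) ^ M * (real M ^ M / real n ^ M) = 1"
        using n(2) by (cases "M = 0") (simp_all add: power_divide)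
      have "norm (fps_nth a n * of_real R ^ n) = norm (fps_nth a n) * R ^ n"
        using R by (simp add: norm_mult norm_power)
      also have "\<dots> = norm (fps_nth a n) * (R ^ k * R ^ M) * ((real n / real M) ^ M * (real M ^ M / real n ^ M))"
        by (simp only: p1 p2 mult_1_right)
      also have "\<dots> = (norm (fps_nth a n) * (real n / real M) ^ M * R ^ k) * (R ^ M * real M ^ M / real n ^ M)"
        by (simp only: mult_ac times_divide_eq_right)
      also have "\<dots> \<le> B * (R ^ M * real M ^ M / real n ^ M)"
        using R by (intro mult_right_mono 2) auto
      also have "\<dots> = (B * R ^ M * of_nat M ^ M) * norm (1 / of_nat n ^ M :: complex)"
        by (simp add: norm_divide norm_power)
      finally show ?case .
    qed
  qed
qed

text \<open>For \<open>s = csqrt (c - z)\<close> one has \<open>ds / dz = - 1 / (2 * s)\<close>, so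
  each derivative lowers the even power of \<open>s\<close> by two and keeps the cofactor
  holomorphic on \<open>S\<close>. After \<open>M\<close> derivatives no power of \<open>s\<close>
  is left, in particular no negative one; this keeps the result bounded as \<open>z\<close>
  approaches \<open>c\<close>, although \<open>c\<close> itself lies outside
  \<open>T\<close>.\<close>

lemma higher_deriv_csqrt_power_mult:
  assumes "open T" "open S" "Q holomorphic_on S"
    and "\<And>z. z \<in> T \<Longrightarrow> c - z \<notin> \<real>\<^sub>\<le>\<^sub>0" "\<And>z. z \<in> T \<Longrightarrow> csqrt (c - z) \<in> S"
  shows "\<exists>Q'. Q' holomorphic_on S \<and>
           (\<forall>z\<in>T. (deriv ^^ M) (\<lambda>z. csqrt (c - z) ^ (2 * M) * Q (csqrt (c - z))) z = Q' (csqrt (c - z)))"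
  using assms(3)
proof (induction M arbitrary: Q)
  case 0
  then show ?case by auto
next
  case (Suc M)
  \<comment> \<open>The cofactor of \<open>s ^ (2 * M)\<close> in the derivative of
    \<open>s ^ (2 * M + 2) * Q s\<close> with respect to \<open>z\<close>.\<close>
  define Q1 where "Q1 = (\<lambda>s. - (of_nat (2 * M + 2) * Q s + s * deriv Q s) / 2)"
  let ?F = "\<lambda>M Q z. csqrt (c - z) ^ (2 * M) * Q (csqrt (c - z))"
  have Q1: "Q1 holomorphic_on S"
    unfolding Q1_def using Suc.prems assms(2) by (auto intro!: holomorphic_intros)
  have holF: "?F m q holomorphic_on T" if "q holomorphic_on S" for q m
  proof -
    have cs: "(\<lambda>z. csqrt (c - z)) holomorphic_on T"
      using assms(4) by (intro holomorphic_on_csqrt' holomorphic_intros) auto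
    then have "(\<lambda>z. q (csqrt (c - z))) holomorphic_on T"
      using holomorphic_on_compose_gen[OF cs that] assms(5) by (auto simp: o_def)
    with cs show ?thesis by (intro holomorphic_on_mult holomorphic_on_power)
  qed
  have d: "deriv (?F (Suc M) Q) z = ?F M Q1 z" if z: "z \<in> T" for z
  proof (rule DERIV_imp_deriv)
    define s where "s = csqrt (c - z)"
    have s0: "s \<noteq> 0"
      using assms(4)[OF z] by (auto simp: s_def)
    have cs: "((\<lambda>z. csqrt (c - z)) has_field_derivative - (1 / (2 * s))) (at z)"
      using assms(4)[OF z] by (auto intro!: derivative_eq_intros simp: s_def)
    have "(Q has_field_derivative deriv Q s) (at s)"
      using Suc.prems assms(2) assms(5)[OF z] by (intro holomorphic_derivI) (auto simp: s_def)
    moreover have "((\<lambda>s. s ^ (2 * Suc M)) has_field_derivative of_nat (2 * Suc M) * s ^ (2 * M + 1)) (at s)"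
      using DERIV_power[OF DERIV_ident, of "2 * Suc M" s UNIV] by simp
    ultimately have "((\<lambda>s. s ^ (2 * Suc M) * Q s) has_field_derivative
        of_nat (2 * Suc M) * s ^ (2 * M + 1) * Q s + s ^ (2 * Suc M) * deriv Q s) (at s)"
      using DERIV_mult' by (fastforce simp: algebra_simps)
    from DERIV_chain2[OF this[unfolded s_def] cs[unfolded s_def]]
    have "(?F (Suc M) Q has_field_derivative
        (of_nat (2 * Suc M) * s ^ (2 * M + 1) * Q s + s ^ (2 * Suc M) * deriv Q s) * - (1 / (2 * s))) (at z)"
      by (simp only: s_def)
    also have "(of_nat (2 * Suc M) * s ^ (2 * M + 1) * Q s + s ^ (2 * Suc M) * deriv Q s) * - (1 / (2 * s)) = s ^ (2 * M) * Q1 s"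
      using s0 by (simp add: Q1_def field_simps)
    finally show "(?F (Suc M) Q has_field_derivative ?F M Q1 z) (at z)"
      by (simp only: s_def)
  qed
  obtain Q' where Q': "Q' holomorphic_on S" "\<forall>z\<in>T. (deriv ^^ M) (?F M Q1) z = Q' (csqrt (c - z))"
    using Suc.IH[OF Q1] by blast
  have "(deriv ^^ Suc M) (?F (Suc M) Q) z = Q' (csqrt (c - z))" if "z \<in> T" for z
  proof -
    have "(deriv ^^ Suc M) (?F (Suc M) Q) z = (deriv ^^ M) (deriv (?F (Suc M) Q)) z"
      by (simp only: funpow_Suc_right o_apply)
    also have "\<dots> = (deriv ^^ M) (?F M Q1) z"
    proof (rule higher_deriv_transform_within_open[of _ T])
      show "deriv (?F (Suc M) Q) holomorphic_on T"
        using holF[OF Suc.prems, of "Suc M"] assms(1) by (rule holomorphic_deriv)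
    qed (use that d assms(1) holF[OF Q1] in blast)+
    also have "\<dots> = Q' (csqrt (c - z))"
      using Q'(2) that by blast
    finally show ?thesis .
  qed
  with Q'(1) show ?case by blast
qed

section \<open>Coefficients of half-integer powers of \<open>R - z\<close>\<close>

text \<open>The binomial series of \<open>(1 - z / R) powr (k / 2)\<close>, scaled by
  \<open>sqrt R ^ k\<close>.\<close>

lemma csqrt_power_has_fps_expansion:
  assumes R: "R > 0"
  shows "(\<lambda>z. csqrt (of_real R - z) ^ k) has_fps_expansion
           Abs_fps (\<lambda>n. of_real (sqrt R) ^ k * ((-1) ^ n * (of_nat k / 2 gchoose n)) / of_real R ^ n)"
proof (rule has_fps_expansionI)
  have "\<forall>\<^sub>F u :: complex in nhds 0. u \<in> ball 0 R"
    using R by (intro eventually_nhds_in_open) auto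
  then show "\<forall>\<^sub>F u in nhds 0. (\<lambda>n. fps_nth (Abs_fps (\<lambda>n. of_real (sqrt R) ^ k * ((-1) ^ n * (of_nat k / 2 gchoose n)) / of_real R ^ n)) n * u ^ n) sums csqrt (of_real R - u) ^ k"
  proof eventually_elim
    case (elim u)
    define w where "w = 1 + - u / of_real R"
    have "norm (- u / of_real R) < 1"
      using elim R by (simp add: norm_divide)
    from gen_binomial_complex[OF this, of "of_nat k / 2"]
    have "(\<lambda>n. of_real (sqrt R) ^ k * ((of_nat k / 2 gchoose n) * (- u / of_real R) ^ n)) sums (of_real (sqrt R) ^ k * w powr (of_nat k / 2))"
      unfolding w_def by (rule sums_mult)
    moreover have "(- u / of_real R) ^ n = (-1) ^ n * u ^ n / of_real R ^ n" for n
      by (simp only: power_divide power_minus[of u])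
    ultimately have "(\<lambda>n. of_real (sqrt R) ^ k * ((-1) ^ n * (of_nat k / 2 gchoose n)) / of_real R ^ n * u ^ n) sums (of_real (sqrt R) ^ k * w powr (of_nat k / 2))"
      by (simp add: mult_ac)
    also have "of_real (sqrt R) ^ k * w powr (of_nat k / 2) = csqrt (of_real R - u) ^ k"
    proof -
      have "w \<noteq> 0"
        using elim R by (auto simp: w_def field_simps)
      then have "w powr (of_nat k / 2) = csqrt w ^ k"
        by (simp add: csqrt_conv_powr powr_def flip: exp_of_nat_mult)
      \<comment> \<open>The principal root is multiplicative here because the factor
        \<open>R\<close> is a positive real, so adding the arguments does not leave the principal
        range.\<close>
      moreover have "of_real (sqrt R) * csqrt w = csqrt (of_real R - u)"
      proof -
        have "of_real R - u = of_real R * w"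
          using R by (simp add: w_def field_simps)
        then show ?thesis
          using R Arg_of_real[of R] mpi_less_Arg[of w] Arg_le_pi[of w]
          by (simp add: csqrt_mult)
      qed
      ultimately show ?thesis by (simp flip: power_mult_distrib)
    qed
    finally show ?case by simp
  qed
qed

text \<open>For even \<open>k\<close> the binomial coefficient vanishes for large \<open>n\<close>.
  For \<open>k = 2 * j + 1\<close> its natural weight is \<open>n powr (j + 3/2)\<close>; passing to
  the common weight \<open>n powr (3/2)\<close> costs a factor \<open>1 / n ^ j\<close>, the
  \<open>monom 1 j\<close> below, so only \<open>k = 1\<close> reaches the constant term.\<close>

lemma gbinomial_half_inv_expansion:
  obtains p where
    "inv_expansion K (\<lambda>n. (-1) ^ n * (of_nat k / 2 gchoose n) * of_real (real n powr (3/2))) p"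
    "K \<ge> 1 \<Longrightarrow> coeff p 0 = (if k = 1 then inverse (Gamma (- 1 / 2)) else 0)"
proof (cases "even k")
  case True
  then obtain j where j: "k = 2 * j" by blast
  have "inv_expansion K (\<lambda>n. (-1) ^ n * (of_nat k / 2 gchoose n) * of_real (real n powr (3/2))) 0"
  proof (rule inv_expansion_cong)
    show "inv_expansion K (\<lambda>_. 0) 0" by (simp add: inv_expansion_def)
    show "\<forall>\<^sub>F n in sequentially. 0 = (-1) ^ n * (of_nat k / 2 gchoose n) * complex_of_real (real n powr (3/2))"
      using eventually_gt_at_top[of j]
    proof eventually_elim
      case (elim n)
      have "(of_nat k / 2 :: complex) = of_nat j" by (simp add: j)
      then have "(of_nat k / 2 gchoose n :: complex) = 0"
        using elim by (simp add: binomial_eq_0 flip: binomial_gbinomial)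
      then show ?case by simp
    qed
  qed
  with True show thesis by (intro that) auto
next
  case False
  then obtain j where j: "k = 2 * j + 1" by (elim oddE)
  define \<alpha> :: complex where "\<alpha> = of_nat k / 2"
  obtain p where p: "inv_expansion K (\<lambda>n. (-1) ^ n * (\<alpha> gchoose n) * exp ((\<alpha> + 1) * of_real (ln (real n)))) p"
      "K \<ge> 1 \<Longrightarrow> coeff p 0 = inverse (Gamma (- \<alpha>))"
    using gbinomial_inv_expansion by blast
  have "inv_expansion K (\<lambda>n. (-1) ^ n * (\<alpha> gchoose n) * of_real (real n powr (3/2))) (p * monom 1 j)"
  proof (rule inv_expansion_cong[OF _ inv_expansion_mult[OF p(1) inv_expansion_poly]])
    show "\<forall>\<^sub>F n in sequentially. (-1) ^ n * (\<alpha> gchoose n) * exp ((\<alpha> + 1) * of_real (ln (real n))) * poly (monom 1 j) (1 / of_nat n) =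
        (-1) ^ n * (\<alpha> gchoose n) * of_real (real n powr (3/2))"
      using eventually_gt_at_top[of 0]
    proof eventually_elim
      case (elim n)
      have "\<alpha> + 1 = of_real (real j + 3/2)"
        by (simp add: \<alpha>_def j add_divide_distrib)
      then have "exp ((\<alpha> + 1) * of_real (ln (real n))) = of_real (real n powr (real j + 3/2))"
        using elim by (simp add: powr_def flip: exp_of_real)
      also have "real n powr (real j + 3/2) = real n ^ j * real n powr (3/2)"
        using elim by (simp add: powr_add powr_realpow)
      finally show ?case
        using elim by (simp add: poly_monom power_divide)
    qed
  qed
  moreover have "coeff (p * monom 1 j) 0 = (if k = 1 then inverse (Gamma (- 1 / 2)) else 0)" if "K \<ge> 1"
    using p(2)[OF that] by (cases "j = 0") (auto simp: coeff_mult j \<alpha>_def coeff_monom)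
  ultimately show thesis
    unfolding \<alpha>_def by (rule that)
qed

section \<open>Darboux's method\<close>

text \<open>Local bounds at every point of the closed disc, combined by compactness. Away from
  \<open>R\<close> both \<open>f\<close> and the subtracted terms continue holomorphically; at
  \<open>R\<close> the derivative is again a holomorphic function of \<open>csqrt (R - z)\<close>,
  which stays in a small closed disc.\<close>

lemma sqrt_singularity_remainder_bounded:
  assumes R: "R > 0" and hol: "f holomorphic_on ball 0 R"
    and sphere: "\<And>\<zeta>. \<zeta> \<in> sphere 0 R - {of_real R} \<Longrightarrow>
      \<exists>V f'. open V \<and> \<zeta> \<in> V \<and> f' holomorphic_on V \<and> (\<forall>z\<in>V \<inter> ball 0 R. f' z = f z)"
    and q: "q analytic_on {0}" and \<delta>: "\<delta> > 0"
    and fG: "\<And>z. z \<in> ball (of_real R) \<delta> \<inter> ball 0 R \<Longrightarrow>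
      f z = poly p (csqrt (of_real R - z)) + csqrt (of_real R - z) ^ (2 * M) * q (csqrt (of_real R - z))"
  shows "bounded ((deriv ^^ M) (\<lambda>z. f z - poly p (csqrt (of_real R - z))) ` ball 0 R)"
proof (rule compact_locally_bounded_imp_bounded)
  define H where "H = {z. Re z < R}"
  have H: "open H" unfolding H_def by (rule open_halfspace_Re_lt)
  have nonpos: "of_real R - z \<notin> \<real>\<^sub>\<le>\<^sub>0" if "z \<in> H" for z
    using that by (auto simp: H_def complex_nonpos_Reals_iff)
  have ball_H: "ball 0 R \<subseteq> H"
    by (auto simp: H_def intro: le_less_trans[OF complex_Re_le_cmod])
  define P where "P = (\<lambda>z. poly p (csqrt (of_real R - z)))"
  have cs: "(\<lambda>z. csqrt (of_real R - z)) holomorphic_on H"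
    using nonpos by (intro holomorphic_on_csqrt' holomorphic_intros) auto
  have holP: "P holomorphic_on H"
    unfolding P_def poly_altdef by (intro holomorphic_on_sum holomorphic_on_mult holomorphic_on_const holomorphic_on_power cs)
  let ?F = "\<lambda>z. f z - P z"
  have holF: "?F holomorphic_on ball 0 R"
    using hol holP ball_H by (intro holomorphic_intros) (auto intro: holomorphic_on_subset)
  fix \<zeta> :: complex assume \<zeta>: "\<zeta> \<in> cball 0 R"
  have "\<exists>T. open T \<and> \<zeta> \<in> T \<and> bounded ((deriv ^^ M) ?F ` (T \<inter> ball 0 R))"
  proof (cases "\<zeta> = of_real R")
    case False
    have "\<exists>V f'. open V \<and> \<zeta> \<in> V \<and> f' holomorphic_on V \<and> (\<forall>z\<in>V \<inter> ball 0 R. f' z = f z)"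
    proof (cases "\<zeta> \<in> ball 0 R")
      case True
      with hol show ?thesis by (intro exI[of _ "ball 0 R"] exI[of _ f]) auto
    next
      case F: False
      with \<zeta> False show ?thesis by (intro sphere) auto
    qed
    then obtain V f' where V: "open V" "\<zeta> \<in> V" "f' holomorphic_on V" "\<And>z. z \<in> V \<inter> ball 0 R \<Longrightarrow> f' z = f z"
      by blast
    \<comment> \<open>The closed disc meets the line \<open>Re z = R\<close> only at
      \<open>R\<close>; elsewhere \<open>csqrt (R - z)\<close> is therefore holomorphic near the
      point, and so is \<open>P\<close>.\<close>
    have "\<zeta> \<in> H"
    proof (rule ccontr)
      assume "\<zeta> \<notin> H"
      then have 1: "Re \<zeta> \<ge> R" by (simp add: H_def)
      have 2: "norm \<zeta> \<le> R" using \<zeta> by simp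
      with 1 complex_Re_le_cmod[of \<zeta>] have 3: "Re \<zeta> = R" "norm \<zeta> = R" by linarith+
      then have "R\<^sup>2 = R\<^sup>2 + (Im \<zeta>)\<^sup>2"
        using cmod_power2[of \<zeta>] by simp
      with 3 False show False by (auto simp: complex_eq_iff)
    qed
    then obtain e where e: "e > 0" "cball \<zeta> e \<subseteq> V \<inter> H"
      using V(1,2) H open_contains_cball[of "V \<inter> H"] by blast
    have hol': "(\<lambda>z. f' z - P z) holomorphic_on V \<inter> H"
      using V(3) holP by (intro holomorphic_intros) (auto intro: holomorphic_on_subset)
    have "(deriv ^^ M) (\<lambda>z. f' z - P z) holomorphic_on V \<inter> H"
      using hol' V(1) H by (intro holomorphic_higher_deriv) auto
    then have "continuous_on (cball \<zeta> e) ((deriv ^^ M) (\<lambda>z. f' z - P z))"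
      using e by (intro holomorphic_on_imp_continuous_on) (auto intro: holomorphic_on_subset)
    then have "bounded ((deriv ^^ M) (\<lambda>z. f' z - P z) ` cball \<zeta> e)"
      by (intro compact_imp_bounded compact_continuous_image) auto
    moreover have "(deriv ^^ M) ?F z = (deriv ^^ M) (\<lambda>z. f' z - P z) z" if "z \<in> ball \<zeta> e \<inter> ball 0 R" for z
    proof (rule higher_deriv_transform_within_open[of _ "ball \<zeta> e \<inter> ball 0 R"])
      show "?F holomorphic_on ball \<zeta> e \<inter> ball 0 R"
        by (rule holomorphic_on_subset[OF holF]) auto
      show "(\<lambda>z. f' z - P z) holomorphic_on ball \<zeta> e \<inter> ball 0 R"
        by (rule holomorphic_on_subset[OF hol']) (use e ball_subset_cball in blast)
      show "?F w = f' w - P w" if "w \<in> ball \<zeta> e \<inter> ball 0 R" for w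
        using that V(4)[of w] e(2) ball_subset_cball[of \<zeta> e] by (auto simp: subset_iff)
    qed (use that in auto)
    then have "(deriv ^^ M) ?F ` (ball \<zeta> e \<inter> ball 0 R) \<subseteq> (deriv ^^ M) (\<lambda>z. f' z - P z) ` cball \<zeta> e"
      by (intro image_subsetI) auto
    ultimately show ?thesis
      using e(1) by (intro exI[of _ "ball \<zeta> e"]) (auto intro: bounded_subset)
  next
    case True
    from q obtain r where r: "r > 0" "q holomorphic_on ball 0 r"
      unfolding analytic_on_def by auto
    \<comment> \<open>Squaring the radius in \<open>z\<close> corresponds to the square root:
      \<open>norm (R - z) < d\<close> keeps \<open>csqrt (R - z)\<close> within
      \<open>r / 2\<close>, strictly inside the domain of \<open>q\<close>.\<close>
    define d where "d = min \<delta> ((r / 2)\<^sup>2)"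
    have "sqrt d \<le> sqrt ((r / 2)\<^sup>2)"
      unfolding d_def by (intro real_sqrt_le_mono) simp
    then have d: "d > 0" "d \<le> \<delta>" "sqrt d \<le> r / 2"
      using r \<delta> by (auto simp: d_def)
    let ?T = "ball (of_real R) d \<inter> ball 0 R"
    have small: "csqrt (of_real R - z) \<in> cball 0 (r / 2)" if "z \<in> ?T" for z
    proof -
      have "norm (of_real R - z) \<le> d"
        using that by (auto simp: dist_norm)
      then have "sqrt (norm (of_real R - z)) \<le> sqrt d" by (rule real_sqrt_le_mono)
      with d(3) have "sqrt (norm (of_real R - z)) \<le> r / 2" by linarith
      then show ?thesis by simp
    qed
    have "\<exists>Q'. Q' holomorphic_on ball 0 r \<and> (\<forall>z\<in>?T. (deriv ^^ M)
        (\<lambda>z. csqrt (of_real R - z) ^ (2 * M) * q (csqrt (of_real R - z))) z = Q' (csqrt (of_real R - z)))"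
    proof (rule higher_deriv_csqrt_power_mult)
      show "csqrt (of_real R - z) \<in> ball 0 r" if "z \<in> ?T" for z
        using small[OF that] r by auto
      show "of_real R - z \<notin> \<real>\<^sub>\<le>\<^sub>0" if "z \<in> ?T" for z :: complex
        using that ball_H by (intro nonpos) auto
    qed (use r(2) in auto)
    then obtain Q' where Q': "Q' holomorphic_on ball 0 r"
      "\<forall>z\<in>?T. (deriv ^^ M) (\<lambda>z. csqrt (of_real R - z) ^ (2 * M) * q (csqrt (of_real R - z))) z = Q' (csqrt (of_real R - z))"
      by blast
    have "(deriv ^^ M) ?F z = Q' (csqrt (of_real R - z))" if z: "z \<in> ?T" for z
    proof -
      have eq: "?F z = csqrt (of_real R - z) ^ (2 * M) * q (csqrt (of_real R - z))" if "z \<in> ?T" for z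
        using fG[of z] that d(2) by (auto simp: P_def)
      have holT: "?F holomorphic_on ?T"
        by (rule holomorphic_on_subset[OF holF]) auto
      then have holT': "(\<lambda>z. csqrt (of_real R - z) ^ (2 * M) * q (csqrt (of_real R - z))) holomorphic_on ?T"
        by (rule holomorphic_transform) (rule eq)
      have "(deriv ^^ M) ?F z = (deriv ^^ M) (\<lambda>z. csqrt (of_real R - z) ^ (2 * M) * q (csqrt (of_real R - z))) z"
        by (rule higher_deriv_transform_within_open[OF holT holT' _ z eq]) auto
      also have "\<dots> = Q' (csqrt (of_real R - z))"
        using Q'(2) z by (rule bspec)
      finally show ?thesis .
    qed
    then have "(deriv ^^ M) ?F ` ?T \<subseteq> Q' ` cball 0 (r / 2)"
      using small by (intro image_subsetI) (metis imageI)
    moreover have "bounded (Q' ` cball 0 (r / 2))"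
      using Q'(1) r(1) by (intro compact_imp_bounded compact_continuous_image holomorphic_on_imp_continuous_on)
        (auto intro: holomorphic_on_subset)
    ultimately have "bounded ((deriv ^^ M) ?F ` ?T)"
      by (rule bounded_subset[rotated])
    then show ?thesis
      using d(1) True by (intro exI[of _ "ball (of_real R) d"]) auto
  qed
  then show "\<exists>T. open T \<and> \<zeta> \<in> T \<and> bounded ((deriv ^^ M) (\<lambda>z. f z - poly p (csqrt (of_real R - z))) ` (T \<inter> ball 0 R))"
    by (simp add: P_def)
qed auto

text \<open>
  Darboux's method: subtracting the first terms of the expansion of \<open>f\<close> in powers of
  \<open>sqrt (R - z)\<close> leaves a function whose derivative of order \<open>M\<close> is bounded on the disc, so by
  Cauchy's inequality its coefficients are \<open>O(R\<^sup>-\<^sup>n n\<^sup>-\<^sup>M)\<close>; those of the terms themselves are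
  given by the binomial series.
\<close>

lemma sqrt_singularity_inv_expansion:
  assumes R: "R > 0" and hol: "f holomorphic_on ball 0 R" and a: "f has_fps_expansion a"
    and sphere: "\<And>\<zeta>. \<zeta> \<in> sphere 0 R - {of_real R} \<Longrightarrow>
      \<exists>V f'. open V \<and> \<zeta> \<in> V \<and> f' holomorphic_on V \<and> (\<forall>z\<in>V \<inter> ball 0 R. f' z = f z)"
    and G: "G analytic_on {0}" and \<delta>: "\<delta> > 0"
    and fG: "\<And>z. z \<in> ball (of_real R) \<delta> \<inter> ball 0 R \<Longrightarrow> f z = G (csqrt (of_real R - z))"
  obtains p where
    "inv_expansion K (\<lambda>n. fps_nth a n * of_real R ^ n * of_real (real n powr (3/2))) p"
    "K \<ge> 1 \<Longrightarrow> coeff p 0 = deriv G 0 * of_real (sqrt R) * inverse (Gamma (- 1 / 2))"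
proof -
  \<comment> \<open>Cauchy's bound \<open>1 / n ^ M\<close> has to absorb the weight
    \<open>n powr (3/2)\<close>, which is at most \<open>n ^ 2\<close>, and still leave
    \<open>1 / n ^ K\<close>.\<close>
  define M where "M = K + 2"
  obtain p q where q: "q analytic_on {0}" and Gpq: "\<And>z. G z = poly p z + z ^ (2 * M) * q z"
    and p1: "coeff p 1 = deriv G 0"
  proof -
    have "2 * M > 1" by (simp add: M_def)
    with analytic_taylor[OF G, of "2 * M"] that show thesis by metis
  qed
  let ?F = "\<lambda>z. f z - poly p (csqrt (of_real R - z))"
  define A where "A = (\<Sum>k\<le>degree p. fps_const (coeff p k) *
    Abs_fps (\<lambda>n. of_real (sqrt R) ^ k * ((-1) ^ n * (of_nat k / 2 gchoose n)) / of_real R ^ n))"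
  have bd: "bounded ((deriv ^^ M) ?F ` ball 0 R)"
    by (rule sqrt_singularity_remainder_bounded[OF R hol sphere q \<delta>]) (use fG Gpq in auto)
  have "(\<lambda>z. poly p (csqrt (of_real R - z))) has_fps_expansion A"
    unfolding A_def poly_altdef
    by (intro has_fps_expansion_sum has_fps_expansion_cmult_left csqrt_power_has_fps_expansion R)
  then have Fexp: "?F has_fps_expansion a - A"
    by (intro has_fps_expansion_diff a)
  have "(\<lambda>z. csqrt (of_real R - z)) holomorphic_on ball 0 R"
  proof (intro holomorphic_on_csqrt' holomorphic_intros)
    fix z :: complex assume "z \<in> ball 0 R"
    then have "Re z < R" using complex_Re_le_cmod[of z] by simp
    then show "of_real R - z \<notin> \<real>\<^sub>\<le>\<^sub>0" by (auto simp: complex_nonpos_Reals_iff)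
  qed
  then have holF: "?F holomorphic_on ball 0 R"
    unfolding poly_altdef
    by (intro holomorphic_on_diff holomorphic_on_sum holomorphic_on_mult holomorphic_on_const holomorphic_on_power hol)
  have n32: "(\<lambda>n. of_real (real n powr (3/2)) :: complex) \<in> O(\<lambda>n. of_nat n ^ 2)"
  proof (rule bigoI)
    show "\<forall>\<^sub>F n in sequentially. norm (of_real (real n powr (3/2)) :: complex) \<le> 1 * norm (of_nat n ^ 2 :: complex)"
      using eventually_ge_at_top[of 1]
    proof eventually_elim
      case (elim n)
      have "real n powr (3/2) \<le> real n powr (real 2)"
        using elim by (intro powr_mono) auto
      with elim show ?case by (subst (asm) powr_realpow) (auto simp: norm_power)
    qed
  qed
  have "(\<lambda>n. fps_nth (a - A) n * of_real R ^ n * of_real (real n powr (3/2))) \<in> O(\<lambda>n. 1 / of_nat n ^ M * of_nat n ^ 2)"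
    by (intro landau_o.big.mult n32 fps_nth_bigo_bounded_higher_deriv[OF holF R Fexp bd])
  also have "?this \<longleftrightarrow> (\<lambda>n. fps_nth (a - A) n * of_real R ^ n * of_real (real n powr (3/2))) \<in> O(\<lambda>n. 1 / of_nat n ^ K)"
    by (intro landau_o.big.cong_ex eventually_mono[OF eventually_gt_at_top[of 0]])
       (auto simp: M_def power_add power2_eq_square)
  finally have rem: "inv_expansion K (\<lambda>n. fps_nth (a - A) n * of_real R ^ n * of_real (real n powr (3/2))) 0"
    by (rule inv_expansion_bigo_0)
  have "\<forall>k. \<exists>s. inv_expansion K (\<lambda>n. (-1) ^ n * (of_nat k / 2 gchoose n) * of_real (real n powr (3/2))) s \<and>
      (K \<ge> 1 \<longrightarrow> coeff s 0 = (if k = 1 then inverse (Gamma (- 1 / 2)) else 0))"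
    by (intro allI) (metis gbinomial_half_inv_expansion)
  from choice[OF this] obtain s where
    s: "\<And>k. inv_expansion K (\<lambda>n. (-1) ^ n * (of_nat k / 2 gchoose n) * of_real (real n powr (3/2))) (s k)"
    and s0: "\<And>k. K \<ge> 1 \<Longrightarrow> coeff (s k) 0 = (if k = 1 then inverse (Gamma (- 1 / 2)) else 0)"
    by blast
  define t where "t = (\<Sum>k\<le>degree p. [:coeff p k * of_real (sqrt R) ^ k:] * s k)"
  have "inv_expansion K (\<lambda>n. \<Sum>k\<le>degree p. coeff p k * of_real (sqrt R) ^ k *
      ((-1) ^ n * (of_nat k / 2 gchoose n) * of_real (real n powr (3/2)))) t"
    unfolding t_def
  proof (intro inv_expansion_sum inv_expansion_mult s)
    show "inv_expansion K (\<lambda>n. coeff p k * of_real (sqrt R) ^ k) [:coeff p k * of_real (sqrt R) ^ k:]" for k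
      using inv_expansion_poly[of K "[:coeff p k * of_real (sqrt R) ^ k:]"] by simp
  qed auto
  also have "(\<lambda>n. \<Sum>k\<le>degree p. coeff p k * of_real (sqrt R) ^ k *
      ((-1) ^ n * (of_nat k / 2 gchoose n) * of_real (real n powr (3/2)))) =
      (\<lambda>n. fps_nth A n * of_real R ^ n * of_real (real n powr (3/2)))"
    unfolding A_def fps_sum_nth sum_distrib_right by (intro ext sum.cong refl) (use R in simp)
  finally have "inv_expansion K (\<lambda>n. fps_nth A n * of_real R ^ n * of_real (real n powr (3/2))) t" .
  from inv_expansion_add[OF rem this]
  have "inv_expansion K (\<lambda>n. fps_nth a n * of_real R ^ n * of_real (real n powr (3/2))) t"
    by (simp flip: distrib_right)
  moreover have "coeff t 0 = deriv G 0 * of_real (sqrt R) * inverse (Gamma (- 1 / 2))" if "K \<ge> 1"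
  proof -
    have "coeff t 0 = (\<Sum>k\<le>degree p. if k = 1 then coeff p k * of_real (sqrt R) ^ k * inverse (Gamma (- 1 / 2)) else 0)"
      unfolding t_def coeff_sum by (intro sum.cong) (auto simp: s0[OF that])
    also have "\<dots> = (if 1 \<le> degree p then coeff p 1 * of_real (sqrt R) * inverse (Gamma (- 1 / 2)) else 0)"
      by (simp add: sum.delta)
    also have "\<dots> = coeff p 1 * of_real (sqrt R) * inverse (Gamma (- 1 / 2))"
      by (simp add: coeff_eq_0)
    finally show ?thesis by (simp only: p1)
  qed
  ultimately show thesis by (rule that)
qed

section \<open>From one polynomial for each order to a unique sequence\<close>

lemma poly_inverse_bigoI:
  assumes "\<And>l. l < K \<Longrightarrow> coeff p l = 0"
  shows "(\<lambda>n. poly p (1 / of_nat n :: complex)) \<in> O(\<lambda>n. 1 / of_nat n ^ K)"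
  using assms
proof (induction K arbitrary: p)
  case 0
  then show ?case using poly_inverse_bigo by simp
next
  case (Suc K)
  obtain c q where p: "p = pCons c q" by (cases p)
  have c: "c = 0" using Suc.prems[of 0] by (simp add: p)
  have "(\<lambda>n. poly q (1 / of_nat n :: complex)) \<in> O(\<lambda>n. 1 / of_nat n ^ K)"
    using Suc.prems[of "Suc _"] by (intro Suc.IH) (simp add: p)
  then have "(\<lambda>n. (1 / of_nat n) * poly q (1 / of_nat n :: complex)) \<in> O(\<lambda>n. (1 / of_nat n) * (1 / of_nat n ^ K))"
    by (intro landau_o.big.mult) auto
  then show ?case by (simp add: p c)
qed

text \<open>The constant \<open>C\<close> is multiplied in so that both it and the
  \<open>c l\<close> can be recovered from coefficients, to which uniqueness applies.\<close>

definition expansion_poly :: "complex \<Rightarrow> (nat \<Rightarrow> complex) \<Rightarrow> nat \<Rightarrow> complex poly" where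
  "expansion_poly C c K = smult C (1 + (\<Sum>l=1..K. monom (c l) l))"

lemma coeff_expansion_poly:
  "coeff (expansion_poly C c K) l = (if l = 0 then C else if l \<le> K then C * c l else 0)"
  by (auto simp: expansion_poly_def coeff_sum coeff_monom sum.delta)

lemma poly_expansion_poly: "poly (expansion_poly C c K) x = C * (1 + (\<Sum>l=1..K. c l * x ^ l))"
  by (simp add: expansion_poly_def poly_sum poly_monom)

text \<open>The relative error \<open>\<epsilon>\<close> and the absolute error of the normalised
  sequence differ by the nonzero factor \<open>C\<close>, and for \<open>n > 0\<close> the weights
  can be divided out.\<close>

lemma coeff_expansion_iff:
  assumes R: "R > 0" and C: "C \<noteq> 0"
  shows "coeff_expansion a R C c \<longleftrightarrow>
    (\<forall>K\<ge>1. inv_expansion (K + 1) (\<lambda>n. a n * of_real R ^ n * of_real (real n powr (3/2))) (expansion_poly C c K))"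
    (is "_ \<longleftrightarrow> (\<forall>K\<ge>1. inv_expansion _ ?x _)")
proof
  assume L: "coeff_expansion a R C c"
  show "\<forall>K\<ge>1. inv_expansion (K + 1) ?x (expansion_poly C c K)"
  proof (intro allI impI)
    fix K :: nat assume "K \<ge> 1"
    then obtain \<epsilon> where \<epsilon>: "\<epsilon> \<in> O(\<lambda>n. 1 / of_nat n ^ (K + 1))"
      "\<forall>\<^sub>F n in sequentially. a n = C * (1 / of_real R ^ n) * (1 / of_real (real n powr (3/2))) *
                 (1 + (\<Sum>l=1..K. c l / of_nat n ^ l) + \<epsilon> n)"
      using L unfolding coeff_expansion_def by blast
    have "inv_expansion (K + 1) (\<lambda>n. poly (expansion_poly C c K) (1 / of_nat n) + C * \<epsilon> n) (expansion_poly C c K)"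
      unfolding inv_expansion_def using \<epsilon>(1) C by simp
    moreover have "\<forall>\<^sub>F n in sequentially. poly (expansion_poly C c K) (1 / of_nat n) + C * \<epsilon> n = ?x n"
      using \<epsilon>(2) eventually_gt_at_top[of 0]
    proof eventually_elim
      case (elim n)
      have nz: "of_real R ^ n \<noteq> (0::complex)" "complex_of_real (real n powr (3/2)) \<noteq> 0"
        using R elim by auto
      have "x * (1 / P) * (1 / Q) * y * P * Q = x * y" if "P \<noteq> 0" "Q \<noteq> 0" for x y P Q :: complex
        using that by simp
      note this[OF nz]
      then have "?x n = C * (1 + (\<Sum>l=1..K. c l / of_nat n ^ l) + \<epsilon> n)"
        unfolding elim(1) .
      then show ?case
        by (simp add: poly_expansion_poly power_divide distrib_left)
    qed
    ultimately show "inv_expansion (K + 1) ?x (expansion_poly C c K)"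
      by (rule inv_expansion_cong[rotated])
  qed
next
  assume *: "\<forall>K\<ge>1. inv_expansion (K + 1) ?x (expansion_poly C c K)"
  show "coeff_expansion a R C c"
    unfolding coeff_expansion_def
  proof (intro allI impI)
    fix K :: nat assume K: "K \<ge> 1"
    define \<epsilon> where "\<epsilon> = (\<lambda>n. (?x n - poly (expansion_poly C c K) (1 / of_nat n)) / C)"
    have "\<epsilon> \<in> O(\<lambda>n. 1 / of_nat n ^ (K + 1))"
      using * K C by (simp add: \<epsilon>_def inv_expansion_def)
    moreover have "\<forall>\<^sub>F n in sequentially. a n = C * (1 / of_real R ^ n) * (1 / of_real (real n powr (3/2))) *
                 (1 + (\<Sum>l=1..K. c l / of_nat n ^ l) + \<epsilon> n)"
      using eventually_gt_at_top[of 0]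
    proof eventually_elim
      case (elim n)
      have "1 + (\<Sum>l=1..K. c l / of_nat n ^ l) + \<epsilon> n = ?x n / C"
        using C by (simp add: \<epsilon>_def poly_expansion_poly power_divide field_simps)
      then show ?case
        using C R elim by (simp add: field_simps)
    qed
    ultimately show "\<exists>\<epsilon>. \<epsilon> \<in> O(\<lambda>n. 1 / of_nat n ^ (K + 1)) \<and>
        (\<forall>\<^sub>F n in sequentially. a n = C * (1 / of_real R ^ n) * (1 / of_real (real n powr (3/2))) *
                 (1 + (\<Sum>l=1..K. c l / of_nat n ^ l) + \<epsilon> n))"
      by blast
  qed
qed

text \<open>The polynomials obtained for different orders agree in every coefficient that both
  orders determine, so one sequence serves all \<open>K\<close>. The same comparison forces any
  competitor to have the same coefficients.\<close>

lemma coeff_expansion_ex_unique: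
  assumes R: "R > 0" and C: "C \<noteq> 0"
    and ex: "\<And>K. \<exists>p. inv_expansion K (\<lambda>n. a n * of_real R ^ n * of_real (real n powr (3/2))) p \<and>
      (K \<ge> 1 \<longrightarrow> coeff p 0 = C)"
  shows "\<exists>C c. C \<noteq> 0 \<and> coeff_expansion a R C c \<and>
           (\<forall>C' c'. C' \<noteq> 0 \<and> coeff_expansion a R C' c' \<longrightarrow> C' = C \<and> (\<forall>l\<ge>1. c' l = c l))"
proof -
  let ?x = "\<lambda>n. a n * of_real R ^ n * of_real (real n powr (3/2))"
  from ex obtain p where p: "\<And>K. inv_expansion K ?x (p K)" "\<And>K. K \<ge> 1 \<Longrightarrow> coeff (p K) 0 = C"
    by metis
  \<comment> \<open>Order \<open>l + 1\<close> is the first one that determines the coefficient of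
    degree \<open>l\<close>.\<close>
  define c where "c = (\<lambda>l. coeff (p (l + 1)) l / C)"
  have "inv_expansion (K + 1) ?x (expansion_poly C c K)" for K
  proof -
    have "coeff (p (K + 1) - expansion_poly C c K) l = 0" if "l < K + 1" for l
      using that p(2)[of "K + 1"] inv_expansion_unique[OF p(1)[of "K + 1"] p(1)[of "l + 1"], of l] C
      by (cases "l = 0") (auto simp: coeff_expansion_poly c_def)
    from poly_inverse_bigoI[OF this]
    have "(\<lambda>n. poly (p (K + 1) - expansion_poly C c K) (1 / of_nat n)) \<in> O(\<lambda>n. 1 / of_nat n ^ (K + 1))" .
    with p(1)[of "K + 1"] show ?thesis
      unfolding inv_expansion_def by (auto dest: sum_in_bigo(1))
  qed
  then have 1: "coeff_expansion a R C c"
    using R C by (simp add: coeff_expansion_iff del: add_Suc_right)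
  have "C' = C \<and> (\<forall>l\<ge>1. c' l = c l)" if "C' \<noteq> 0" "coeff_expansion a R C' c'" for C' c'
  proof -
    have e: "inv_expansion (K + 1) ?x (expansion_poly C' c' K)" "inv_expansion (K + 1) ?x (expansion_poly C c K)"
      if "K \<ge> 1" for K
      using that \<open>C' \<noteq> 0\<close> \<open>coeff_expansion a R C' c'\<close> 1 R C coeff_expansion_iff by blast+
    have eq: "coeff (expansion_poly C' c' K) l = coeff (expansion_poly C c K) l" if "K \<ge> 1" "l \<le> K" for K l
      using inv_expansion_unique[OF e[OF that(1)], of l] that(2) by simp
    have "C' = C"
      using eq[of 1 0] by (simp add: coeff_expansion_poly)
    moreover have "c' l = c l" if "l \<ge> 1" for l
      using eq[of l l] that \<open>C' = C\<close> C by (simp add: coeff_expansion_poly)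
    ultimately show ?thesis by blast
  qed
  with 1 C show ?thesis by blast
qed

section \<open>The inverse of a function near a simple critical point\<close>

text \<open>A simple critical point makes \<open>R - \<Lambda>\<close> the square of a local
  coordinate \<open>\<psi>\<close>. Along \<open>w\<close> this gives
  \<open>\<psi> (w z) ^ 2 = R - z\<close>, so \<open>\<psi> (w z)\<close> is
  \<open>csqrt (R - z)\<close> up to a sign; inverting \<open>\<psi>\<close> expresses
  \<open>w\<close>, hence \<open>g (w z)\<close>, through the root.\<close>

lemma sqrt_branch_at_critical_point:
  fixes \<Lambda> g w :: "complex \<Rightarrow> complex"
  assumes R: "R > 0"
    and \<Lambda>: "\<Lambda> analytic_on {0}" "deriv \<Lambda> 0 = 0" "deriv (deriv \<Lambda>) 0 \<noteq> 0"
    and g: "g analytic_on {0}"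
    and \<delta>: "\<delta> > 0" and w: "continuous_on (cball 0 R \<inter> ball (of_real R) \<delta>) w" "w (of_real R) = 0"
    and inv: "\<And>z. z \<in> ball 0 R \<inter> ball (of_real R) \<delta> \<Longrightarrow> \<Lambda> (w z) = z"
  obtains G \<epsilon> where "G analytic_on {0}" "deriv g 0 \<noteq> 0 \<Longrightarrow> deriv G 0 \<noteq> 0" "\<epsilon> > 0"
    "\<And>z. z \<in> ball (of_real R) \<epsilon> \<inter> ball 0 R \<Longrightarrow> g (w z) = G (csqrt (of_real R - z))"
proof -
  let ?R = "of_real R :: complex"
  let ?S = "ball 0 R \<inter> ball ?R \<delta>"
  have w_lim: "(w \<longlongrightarrow> 0) (at ?R within cball 0 R \<inter> ball ?R \<delta>)"
  proof -
    have "?R \<in> cball 0 R \<inter> ball ?R \<delta>" using R \<delta> by auto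
    with w(1) have "(w \<longlongrightarrow> w ?R) (at ?R within cball 0 R \<inter> ball ?R \<delta>)"
      unfolding continuous_on_def by (rule bspec)
    then show ?thesis by (simp only: w(2))
  qed
  \<comment> \<open>The relation \<open>\<Lambda> (w z) = z\<close> is assumed in the open disc only
    and is carried to the boundary point \<open>R\<close> by continuity.\<close>
  have "\<Lambda> 0 = ?R"
  proof -
    have "ball ?R \<delta> \<inter> closure (ball 0 R) \<subseteq> closure (ball ?R \<delta> \<inter> ball 0 R)"
      by (intro open_Int_closure_subset) auto
    moreover have "?R \<in> ball ?R \<delta> \<inter> closure (ball 0 R)"
      using R \<delta> by auto
    ultimately have "?R \<in> closure ?S"
      by (auto simp: Int_commute)
    then have nt: "at ?R within ?S \<noteq> bot"
      using R by (auto simp: closure_def trivial_limit_within)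
    have "(w \<longlongrightarrow> 0) (at ?R within ?S)"
      by (rule tendsto_within_subset[OF w_lim]) auto
    then have "((\<lambda>z. \<Lambda> (w z)) \<longlongrightarrow> \<Lambda> 0) (at ?R within ?S)"
      by (rule isCont_tendsto_compose[OF analytic_at_imp_isCont[OF \<Lambda>(1)]])
    moreover have "((\<lambda>z. \<Lambda> (w z)) \<longlongrightarrow> ?R) (at ?R within ?S)"
    proof (rule Lim_transform_eventually)
      show "((\<lambda>z. z) \<longlongrightarrow> ?R) (at ?R within ?S)" by (rule tendsto_ident_at)
      show "\<forall>\<^sub>F z in at ?R within ?S. z = \<Lambda> (w z)"
        by (auto simp: eventually_at_filter inv)
    qed
    ultimately show ?thesis
      using nt by (intro tendsto_unique)
  qed
  then obtain k where k: "k analytic_on {0}" "\<And>z. \<Lambda> z = ?R + z ^ 2 * k z" and k0: "k 0 \<noteq> 0"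
    using analytic_second_quotient[OF \<Lambda>(1)] \<Lambda>(2,3) by (metis add_0_right divide_eq_0_iff mult_zero_right zero_neq_numeral)
  \<comment> \<open>A branch of the square root of \<open>- k\<close>: the quotient
    \<open>k z / k 0\<close> is 1 at 0 and thus off the cut, whereas \<open>csqrt (- k z)\<close> is
    not analytic at 0 if \<open>- k 0\<close> is a negative real.\<close>
  define c where "c = csqrt (- k 0)"
  define s where "s = (\<lambda>z. c * csqrt (k z / k 0))"
  define \<psi> where "\<psi> = (\<lambda>z. z * s z)"
  have c0: "c \<noteq> 0" using k0 by (simp add: c_def)
  have s2: "s z ^ 2 = - k z" for z
    using k0 by (simp add: s_def c_def power_mult_distrib)
  have s_an: "s analytic_on {0}"
    unfolding s_def using k(1) k0 by (intro analytic_intros) auto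
  have \<psi>_an: "\<psi> analytic_on {0}"
    unfolding \<psi>_def using s_an by (intro analytic_intros)
  have \<psi>2: "\<psi> z ^ 2 = ?R - \<Lambda> z" for z
    by (simp add: \<psi>_def power_mult_distrib s2 k(2))
  have \<psi>0: "\<psi> 0 = 0" by (simp add: \<psi>_def)
  have "deriv \<psi> 0 = c"
  proof (rule DERIV_imp_deriv)
    have "(s has_field_derivative deriv s 0) (at 0)"
      using analytic_on_imp_differentiable_at[OF s_an] by (simp add: DERIV_deriv_iff_field_differentiable)
    from DERIV_mult'[OF DERIV_ident this] show "(\<psi> has_field_derivative c) (at 0)"
      using k0 by (simp add: \<psi>_def s_def)
  qed
  then have dpsi: "deriv \<psi> 0 \<noteq> 0" using c0 by simp
  obtain S where S: "open S" "0 \<in> S" "\<psi> holomorphic_on S"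
    using \<psi>_an unfolding analytic_at by blast
  obtain r where r: "r > 0" "ball 0 r \<subseteq> S" "inj_on \<psi> (ball 0 r)"
    using has_complex_derivative_locally_injective[OF S(3,2,1) dpsi] by blast
  have \<psi>_hol: "\<psi> holomorphic_on ball 0 r"
    using S(3) r(2) by (rule holomorphic_on_subset)
  obtain \<theta> where \<theta>: "\<theta> holomorphic_on (\<psi> ` ball 0 r)" "\<And>z. z \<in> ball 0 r \<Longrightarrow> deriv \<psi> z * deriv \<theta> (\<psi> z) = 1"
    "\<And>z. z \<in> ball 0 r \<Longrightarrow> \<theta> (\<psi> z) = z"
    using holomorphic_has_inverse[OF \<psi>_hol open_ball r(3)] by blast
  have \<theta>0: "\<theta> 0 = 0" using \<theta>(3)[of 0] r \<psi>0 by simp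
  have \<theta>_an: "\<theta> analytic_on {0}"
    unfolding analytic_at using \<theta>(1) r \<psi>0 open_mapping_thm3[OF \<psi>_hol open_ball r(3)]
    by (intro exI[of _ "\<psi> ` ball 0 r"]) (auto simp: image_iff intro!: bexI[of _ 0])
  have dchi: "deriv \<theta> 0 \<noteq> 0"
    using \<theta>(2)[of 0] r \<psi>0 by auto
  obtain \<epsilon> where \<epsilon>: "\<epsilon> > 0" "\<epsilon> \<le> \<delta>" and w_r: "\<And>z. z \<in> cball 0 R \<inter> ball ?R \<epsilon> \<Longrightarrow> w z \<in> ball 0 r"
  proof -
    from w_lim r(1) have "\<forall>\<^sub>F z in at ?R within cball 0 R \<inter> ball ?R \<delta>. dist (w z) 0 < r"
      by (rule tendstoD)
    then obtain d where d: "d > 0" "\<And>z. z \<in> cball 0 R \<inter> ball ?R \<delta> \<Longrightarrow> z \<noteq> ?R \<Longrightarrow> dist z ?R < d \<Longrightarrow> dist (w z) 0 < r"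
      unfolding eventually_at by blast
    show thesis
    proof (rule that[of "min d \<delta>"])
      show "w z \<in> ball 0 r" if "z \<in> cball 0 R \<inter> ball ?R (min d \<delta>)" for z
        using that d(2)[of z] r(1) w(2) by (cases "z = ?R") (auto simp: dist_commute)
    qed (use d(1) \<delta> in auto)
  qed
  let ?T = "ball ?R \<epsilon> \<inter> ball 0 R"
  \<comment> \<open>The sign relating the two roots; being continuous with values in
    \<open>{1, -1}\<close> on a convex set, it is constant.\<close>
  define \<sigma> where "\<sigma> = (\<lambda>z. \<psi> (w z) / csqrt (?R - z))"
  have nonpos: "?R - z \<notin> \<real>\<^sub>\<le>\<^sub>0" if "z \<in> ?T" for z
  proof -
    have "Re z < R" using that complex_Re_le_cmod[of z] by auto
    then show ?thesis by (auto simp: complex_nonpos_Reals_iff)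
  qed
  have sq: "\<psi> (w z) ^ 2 = csqrt (?R - z) ^ 2" if "z \<in> ?T" for z
    using that \<epsilon>(2) inv[of z] by (simp add: \<psi>2)
  have "\<sigma> constant_on ?T"
  proof (rule continuous_finite_range_constant)
    show "connected ?T"
      by (intro convex_connected convex_Int convex_ball)
    have "continuous_on ?T w"
      by (rule continuous_on_subset[OF w(1)]) (use \<epsilon>(2) in auto)
    then have "continuous_on ?T (\<lambda>z. \<psi> (w z))"
      by (rule continuous_on_compose2[OF holomorphic_on_imp_continuous_on[OF \<psi>_hol]]) (use w_r in auto)
    moreover have "continuous_on ?T (\<lambda>z. csqrt (?R - z))"
      using nonpos by (intro holomorphic_on_imp_continuous_on holomorphic_on_csqrt' holomorphic_intros) auto
    ultimately show "continuous_on ?T \<sigma>"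
      unfolding \<sigma>_def using nonpos by (intro continuous_on_divide) auto
    have "\<sigma> z = 1 \<or> \<sigma> z = -1" if "z \<in> ?T" for z
    proof -
      have "csqrt (?R - z) \<noteq> 0"
        using nonpos[OF that] by auto
      moreover have "\<psi> (w z) = csqrt (?R - z) \<or> \<psi> (w z) = - csqrt (?R - z)"
        using sq[OF that] by (simp only: power2_eq_iff)
      ultimately show ?thesis
        unfolding \<sigma>_def by (elim disjE) (simp_all only: divide_self minus_divide_left [symmetric] simp_thms)
    qed
    then have "\<sigma> ` ?T \<subseteq> {1, -1}"
      by blast
    then show "finite (\<sigma> ` ?T)"
      by (rule finite_subset) auto
  qed
  then obtain e where e: "\<And>z. z \<in> ?T \<Longrightarrow> \<sigma> z = e"
    unfolding constant_on_def by blast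
  \<comment> \<open>Constancy alone would say nothing about \<open>e\<close> if the region were
    empty; an actual point near \<open>R\<close> inside the disc shows that \<open>e\<close> is a
    nonzero value of \<open>\<sigma>\<close>.\<close>
  have e0: "e \<noteq> 0"
  proof -
    have "?R \<in> closure (ball 0 R)" using R by auto
    then obtain z where z: "z \<in> ?T"
      using \<epsilon>(1) closure_approachable[of ?R "ball 0 R"] by (auto simp: dist_commute)
    then have "\<psi> (w z) \<noteq> 0"
      using sq[OF z] nonpos[OF z] by auto
    then show ?thesis
      using e[OF z] nonpos[OF z] by (auto simp: \<sigma>_def)
  qed
  define G where "G = (\<lambda>x. g (\<theta> (e * x)))"
  have m_an: "(\<lambda>x. e * x) analytic_on {0}"
    by (intro analytic_intros)
  have \<theta>e_an: "(\<lambda>x. \<theta> (e * x)) analytic_on {0}"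
    using analytic_on_compose_gen[OF m_an \<theta>_an] by (auto simp: o_def)
  show thesis
  proof (rule that[of G \<epsilon>])
    show "G analytic_on {0}"
      unfolding G_def using analytic_on_compose_gen[OF \<theta>e_an g] \<theta>0 by (auto simp: o_def)
    show "deriv G 0 \<noteq> 0" if "deriv g 0 \<noteq> 0"
    proof -
      have "(g has_field_derivative deriv g 0) (at (\<theta> (e * 0)))"
        using analytic_on_imp_differentiable_at[OF g] \<theta>0 by (simp add: DERIV_deriv_iff_field_differentiable)
      moreover have "(\<theta> has_field_derivative deriv \<theta> 0) (at (e * 0))"
        using analytic_on_imp_differentiable_at[OF \<theta>_an] by (simp add: DERIV_deriv_iff_field_differentiable)
      then have "((\<lambda>x. \<theta> (e * x)) has_field_derivative deriv \<theta> 0 * (e * 1)) (at 0)"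
        by (rule DERIV_chain2) (auto intro!: derivative_eq_intros)
      ultimately have "(G has_field_derivative deriv g 0 * (deriv \<theta> 0 * (e * 1))) (at 0)"
        unfolding G_def by (rule DERIV_chain2)
      then show ?thesis
        using that dchi e0 by (simp add: DERIV_imp_deriv)
    qed
    show "g (w z) = G (csqrt (?R - z))" if z: "z \<in> ?T" for z
    proof -
      have "\<psi> (w z) = e * csqrt (?R - z)"
        using e[OF z] nonpos[OF z] by (auto simp: \<sigma>_def field_simps)
      moreover have "\<theta> (\<psi> (w z)) = w z"
        using z w_r[of z] by (intro \<theta>(3)) auto
      ultimately show ?thesis by (simp add: G_def)
    qed
  qed (use \<epsilon>(1) in auto)
qed

section \<open>Holomorphic functions on curves\<close>

lemma holomorphic_on_locally:
  assumes "\<And>z. z \<in> S \<Longrightarrow> \<exists>T. open T \<and> z \<in> T \<and> f holomorphic_on T"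
  shows "f holomorphic_on S"
proof (rule holomorphic_onI)
  fix z assume "z \<in> S"
  with assms obtain T where "open T" "z \<in> T" "f holomorphic_on T" by blast
  then have "f field_differentiable at z"
    by (rule holomorphic_on_imp_differentiable_at[rotated 1])
  then show "f field_differentiable (at z within S)"
    by (rule field_differentiable_at_within)
qed

lemma complex_chart_inj_on:
  assumes "complex_chart X U \<phi>"
  shows "inj_on \<phi> U"
proof -
  have "U \<subseteq> topspace X"
    using assms openin_subset by (auto simp: complex_chart_def)
  then have "topspace (subtopology X U) = U"
    by (rule topspace_subtopology_subset)
  moreover have "inj_on \<phi> (topspace (subtopology X U))"
    using assms by (auto simp only: complex_chart_def intro: homeomorphic_imp_injective_map)
  ultimately show ?thesis by simp
qed

lemma complex_chart_open_image:
  assumes chart: "complex_chart X U \<phi>" and V: "openin X V"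
  shows "open (\<phi> ` (U \<inter> V))"
proof -
  have "openin (subtopology X U) (U \<inter> V)"
    using V by (rule openin_subtopology_Int2)
  moreover have "open_map (subtopology X U) (top_of_set (\<phi> ` U)) \<phi>"
    using chart by (auto simp: complex_chart_def intro: homeomorphic_imp_open_map)
  ultimately have "openin (top_of_set (\<phi> ` U)) (\<phi> ` (U \<inter> V))"
    by (auto simp: open_map_def)
  then show ?thesis
    using chart by (auto simp: complex_chart_def openin_open_eq)
qed

lemma complex_chart_continuous_map:
  assumes "complex_chart X U \<phi>"
  shows "continuous_map (subtopology X U) euclidean \<phi>"
proof -
  have "continuous_map (subtopology X U) (top_of_set (\<phi> ` U)) \<phi>"
    using assms by (auto simp: complex_chart_def intro: homeomorphic_imp_continuous_map)
  then show ?thesis by (rule continuous_map_into_fulltopology)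
qed

lemma complex_curve_chart_at:
  assumes "complex_curve X A" "x \<in> topspace X"
  obtains V \<psi> where "(V, \<psi>) \<in> A" "x \<in> V" "complex_chart X V \<psi>"
  using assms unfolding complex_curve_def by blast

text \<open>Holomorphy is defined through the charts of \<open>A\<close>, while the chart at
  \<open>p\<close> may be any member of the maximal atlas. Near each point the function factors
  through a chart of \<open>A\<close> and a holomorphic transition map.\<close>

lemma holomorphic_function_on_holomorphic_chart:
  assumes curve: "complex_curve X A" and chart: "holomorphic_chart X A U \<phi>"
    and g: "holomorphic_function_on X A W g"
  shows "(g \<circ> inv_into U \<phi>) holomorphic_on \<phi> ` (U \<inter> W)"
proof (rule holomorphic_on_locally)
  fix z assume "z \<in> \<phi> ` (U \<inter> W)"
  then obtain x where x: "x \<in> U" "x \<in> W" "z = \<phi> x" by blast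
  have W: "openin X W" using g by (simp add: holomorphic_function_on_def)
  have c\<phi>: "complex_chart X U \<phi>" using chart by (simp add: holomorphic_chart_def)
  note inj = complex_chart_inj_on[OF c\<phi>]
  have "x \<in> topspace X" using W x openin_subset by blast
  then obtain V \<psi> where V: "(V, \<psi>) \<in> A" "x \<in> V" "complex_chart X V \<psi>"
    using complex_curve_chart_at[OF curve] by blast
  have oV: "openin X V" using V(3) by (simp add: complex_chart_def)
  let ?T = "\<phi> ` (U \<inter> (V \<inter> W))"
  have "compatible_charts U \<phi> V \<psi>"
    using chart V(1) by (auto simp: holomorphic_chart_def)
  then have "(\<psi> \<circ> inv_into U \<phi>) holomorphic_on ?T"
    by (auto simp: compatible_charts_def intro: holomorphic_on_subset)
  moreover have "(g \<circ> inv_into V \<psi>) holomorphic_on \<psi> ` (V \<inter> W)"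
    using g V(1) by (auto simp: holomorphic_function_on_def)
  moreover have "(\<psi> \<circ> inv_into U \<phi>) ` ?T \<subseteq> \<psi> ` (V \<inter> W)"
    using inj by (auto simp: inv_into_f_f)
  ultimately have "((g \<circ> inv_into V \<psi>) \<circ> (\<psi> \<circ> inv_into U \<phi>)) holomorphic_on ?T"
    by (rule holomorphic_on_compose_gen)
  then have "(g \<circ> inv_into U \<phi>) holomorphic_on ?T"
    by (rule holomorphic_transform)
      (use inj complex_chart_inj_on[OF V(3)] in \<open>auto simp: inv_into_f_f\<close>)
  moreover have "open ?T"
    by (intro complex_chart_open_image[OF c\<phi>] openin_Int oV W)
  ultimately show "\<exists>T. open T \<and> z \<in> T \<and> (g \<circ> inv_into U \<phi>) holomorphic_on T"
    using x V(2) by blast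
qed

section \<open>Compositions with holomorphic maps into the curve\<close>

lemma continuous_map_open_preimage:
  assumes "continuous_map (top_of_set D) X h" "open D" "openin X T"
  shows "open {z \<in> D. h z \<in> T}"
proof -
  have "openin (top_of_set D) {z \<in> D. h z \<in> T}"
    using openin_continuous_map_preimage[OF assms(1,3)] by simp
  with assms(2) show ?thesis by (simp add: openin_open_eq)
qed

lemma holomorphic_on_comp_map_into:
  assumes curve: "complex_curve X A" and h: "holomorphic_map_into X A D h"
    and g: "holomorphic_function_on X A W g"
  shows "(g \<circ> h) holomorphic_on {z \<in> D. h z \<in> W}"
proof (rule holomorphic_on_locally)
  fix z assume z: "z \<in> {z \<in> D. h z \<in> W}"
  have W: "openin X W" using g by (simp add: holomorphic_function_on_def)
  then have "h z \<in> topspace X" using z openin_subset by blast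
  then obtain V \<psi> where V: "(V, \<psi>) \<in> A" "h z \<in> V" "complex_chart X V \<psi>"
    using complex_curve_chart_at[OF curve] by blast
  have oV: "openin X V" using V(3) by (simp add: complex_chart_def)
  let ?T = "{z \<in> D. h z \<in> V \<inter> W}"
  have "open ?T"
    using h W oV by (intro continuous_map_open_preimage) (auto simp: holomorphic_map_into_def)
  have "(\<psi> \<circ> h) holomorphic_on ?T"
    using h V(1) by (auto simp: holomorphic_map_into_def intro: holomorphic_on_subset)
  moreover have "(g \<circ> inv_into V \<psi>) holomorphic_on \<psi> ` (V \<inter> W)"
    using g V(1) by (auto simp: holomorphic_function_on_def)
  moreover have "(\<psi> \<circ> h) ` ?T \<subseteq> \<psi> ` (V \<inter> W)"
    by auto
  ultimately have "((g \<circ> inv_into V \<psi>) \<circ> (\<psi> \<circ> h)) holomorphic_on ?T"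
    by (rule holomorphic_on_compose_gen)
  then have "(g \<circ> h) holomorphic_on ?T"
    by (rule holomorphic_transform) (use complex_chart_inj_on[OF V(3)] in \<open>auto simp: inv_into_f_f\<close>)
  then show "\<exists>T. open T \<and> z \<in> T \<and> (g \<circ> h) holomorphic_on T"
    using \<open>open ?T\<close> z V(2) by blast
qed

lemma continuous_map_image_in_closure:
  assumes h: "continuous_map (top_of_set D) X h" and \<zeta>: "\<zeta> \<in> D" "\<zeta> \<in> closure (D \<inter> S)"
  shows "h \<zeta> \<in> X closure_of (h ` (D \<inter> S))"
  unfolding in_closure_of
proof (intro conjI allI impI)
  show "h \<zeta> \<in> topspace X"
    using h \<zeta>(1) by (auto simp: continuous_map_def)
  fix T assume T: "h \<zeta> \<in> T \<and> openin X T"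
  have "openin (top_of_set D) {z \<in> D. h z \<in> T}"
    using openin_continuous_map_preimage[OF h] T by auto
  then obtain B where B: "open B" "{z \<in> D. h z \<in> T} = D \<inter> B"
    unfolding openin_open by blast
  have "\<zeta> \<in> B" using \<zeta>(1) T B(2) by blast
  with B(1) \<zeta>(2) obtain y where "y \<in> D \<inter> S" "y \<in> B"
    using open_Int_closure_eq_empty[of B "D \<inter> S"] by blast
  with B(2) show "\<exists>y. y \<in> h ` (D \<inter> S) \<and> y \<in> T" by blast
qed

text \<open>The local extension \<open>h\<close> agrees with \<open>u\<close> only inside the disc,
  but by continuity \<open>h \<zeta>\<close> lies in the closure of the image of \<open>u\<close>
  and hence in \<open>W\<close>. Thus \<open>g\<close> is holomorphic around
  \<open>h \<zeta>\<close>, and \<open>g \<circ> h\<close> is the extension sought.\<close>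

lemma holomorphic_extension_comp:
  fixes X :: "'a topology"
  assumes curve: "complex_curve X A"
    and g: "X closure_of (u ` ball 0 R) \<subseteq> W" "holomorphic_function_on X A W g"
    and v: "extends_holomorphically_near X A (ball 0 R) u \<zeta>"
    and \<zeta>: "\<zeta> \<in> closure (ball 0 R)"
  shows "\<exists>V f'. open V \<and> \<zeta> \<in> V \<and> f' holomorphic_on V \<and> (\<forall>z\<in>V \<inter> ball 0 R. f' z = (g \<circ> u) z)"
proof -
  obtain V h where V: "\<zeta> \<in> V" "holomorphic_map_into X A V h" "\<And>z. z \<in> V \<inter> ball 0 R \<Longrightarrow> h z = u z"
    using v unfolding extends_holomorphically_near_def by blast
  have oV: "open V" and ch: "continuous_map (top_of_set V) X h"
    using V(2) by (auto simp: holomorphic_map_into_def)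
  have W: "openin X W" using g(2) by (simp add: holomorphic_function_on_def)
  have "\<zeta> \<in> closure (V \<inter> ball 0 R)"
    using open_Int_closure_subset[OF oV] V(1) \<zeta> by blast
  then have "h \<zeta> \<in> X closure_of (h ` (V \<inter> ball 0 R))"
    by (rule continuous_map_image_in_closure[OF ch V(1)])
  moreover have "h ` (V \<inter> ball 0 R) \<subseteq> u ` ball 0 R"
    using V(3) by auto
  ultimately have "h \<zeta> \<in> W"
    using g(1) closure_of_mono by blast
  moreover have "open {z \<in> V. h z \<in> W}"
    by (rule continuous_map_open_preimage[OF ch oV W])
  moreover have "(g \<circ> h) holomorphic_on {z \<in> V. h z \<in> W}"
    by (rule holomorphic_on_comp_map_into[OF curve V(2) g(2)])
  ultimately show ?thesis
    using V by (intro exI[of _ "{z \<in> V. h z \<in> W}"] exI[of _ "g \<circ> h"]) auto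
qed

theorem theorem3p1:
  fixes X :: "'a topology"
    and A :: "('a set \<times> ('a \<Rightarrow> complex)) set"
    and R :: real
    and u :: "complex \<Rightarrow> 'a"
    and lam g :: "'a \<Rightarrow> complex"
    and W :: "'a set"
    and a :: "complex fps"
    and U :: "'a set"
    and \<phi> :: "'a \<Rightarrow> complex"
  assumes curve: "complex_curve X A"
    and R: "R > 0"
    and u: "holomorphic_map_into X A (ball 0 R) u"
    and lam: "holomorphic_function_on X A (topspace X) lam"
    and g: "X closure_of (u ` ball 0 R) \<subseteq> W" "holomorphic_function_on X A W g"
    and a: "(g \<circ> u) has_fps_expansion a"
    and i: "\<And>z. z \<in> ball 0 R \<Longrightarrow> lam (u z) = z"
    and ii: "continuous_map (top_of_set (cball 0 R)) X u"
    and chart: "holomorphic_chart X A U \<phi>" "u (of_real R) \<in> U" "\<phi> (u (of_real R)) = 0"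
    and iii: "deriv (lam \<circ> inv_into U \<phi>) 0 = 0"
    and iv: "(deriv ^^ 2) (lam \<circ> inv_into U \<phi>) 0 \<noteq> 0"
    and v: "\<And>\<zeta>. \<zeta> \<in> sphere 0 R - {of_real R} \<Longrightarrow>
              extends_holomorphically_near X A (ball 0 R) u \<zeta>"
    and vi: "deriv (g \<circ> inv_into U \<phi>) 0 \<noteq> 0"
  shows "\<exists>C c. C \<noteq> 0 \<and> coeff_expansion (fps_nth a) R C c \<and>
           (\<forall>C' c'. C' \<noteq> 0 \<and> coeff_expansion (fps_nth a) R C' c' \<longrightarrow>
              C' = C \<and> (\<forall>l\<ge>1. c' l = c l))"
proof -
  let ?R = "of_real R :: complex"
  let ?p = "u ?R"
  have W: "openin X W" using g(2) by (simp add: holomorphic_function_on_def)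
  have c\<phi>: "complex_chart X U \<phi>" using chart(1) by (simp add: holomorphic_chart_def)
  have oU: "openin X U" using c\<phi> by (simp add: complex_chart_def)
  have inv: "inv_into U \<phi> (\<phi> x) = x" if "x \<in> U" for x
    using complex_chart_inj_on[OF c\<phi>] that by (rule inv_into_f_f)
  \<comment> \<open>Boundary values of \<open>u\<close> are limits of interior values, so
    \<open>W\<close>, which contains the closure of the image, contains them too; this covers the
    point \<open>p\<close>.\<close>
  have in_W: "u \<zeta> \<in> W" if "\<zeta> \<in> cball 0 R" for \<zeta>
  proof -
    have "\<zeta> \<in> closure (cball 0 R \<inter> ball 0 R)"
      using that R by (simp add: Int_absorb1 ball_subset_cball)
    then have "u \<zeta> \<in> X closure_of (u ` (cball 0 R \<inter> ball 0 R))"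
      by (rule continuous_map_image_in_closure[OF ii that])
    with g(1) show ?thesis
      by (auto simp: Int_absorb1 ball_subset_cball)
  qed
  have hol: "(g \<circ> u) holomorphic_on ball 0 R"
    using holomorphic_on_comp_map_into[OF curve u g(2)]
    by (rule holomorphic_on_subset) (use in_W ball_subset_cball in auto)
  have sphere: "\<exists>V f'. open V \<and> \<zeta> \<in> V \<and> f' holomorphic_on V \<and> (\<forall>z\<in>V \<inter> ball 0 R. f' z = (g \<circ> u) z)"
    if "\<zeta> \<in> sphere 0 R - {?R}" for \<zeta>
    using v[OF that] that R by (intro holomorphic_extension_comp[OF curve g]) auto

  define \<Lambda> where "\<Lambda> = lam \<circ> inv_into U \<phi>"
  define G0 where "G0 = g \<circ> inv_into U \<phi>"
  have pW: "?p \<in> U \<inter> W" using chart(2) in_W[of ?R] R by auto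
  have "\<Lambda> holomorphic_on \<phi> ` (U \<inter> topspace X)"
    unfolding \<Lambda>_def by (rule holomorphic_function_on_holomorphic_chart[OF curve chart(1) lam])
  moreover have "open (\<phi> ` (U \<inter> topspace X))"
    by (rule complex_chart_open_image[OF c\<phi>]) auto
  moreover have "0 \<in> \<phi> ` (U \<inter> topspace X)"
    using chart(2,3) openin_subset[OF oU] by (intro image_eqI[of _ _ ?p]) auto
  ultimately have \<Lambda>_an: "\<Lambda> analytic_on {0}"
    unfolding analytic_at by blast
  have "G0 holomorphic_on \<phi> ` (U \<inter> W)"
    unfolding G0_def by (rule holomorphic_function_on_holomorphic_chart[OF curve chart(1) g(2)])
  moreover have "open (\<phi> ` (U \<inter> W))"
    by (rule complex_chart_open_image[OF c\<phi> W])
  moreover have "0 \<in> \<phi> ` (U \<inter> W)"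
    using chart(3) pW by (intro image_eqI[of _ _ ?p]) auto
  ultimately have G0_an: "G0 analytic_on {0}"
    unfolding analytic_at by blast

  \<comment> \<open>Near \<open>R\<close> the closed disc is mapped into the domain of the chart, so
    there \<open>u\<close> can be replaced by its coordinate
    \<open>\<phi> \<circ> u\<close>.\<close>
  have "openin (top_of_set (cball 0 R)) {z \<in> cball 0 R. u z \<in> U}"
    using openin_continuous_map_preimage[OF ii oU] by simp
  moreover have "?R \<in> {z \<in> cball 0 R. u z \<in> U}"
    using chart(2) R by simp
  ultimately obtain \<delta> where \<delta>: "\<delta> > 0" "ball ?R \<delta> \<inter> cball 0 R \<subseteq> {z \<in> cball 0 R. u z \<in> U}"
    unfolding openin_contains_ball by blast
  have "continuous_map (top_of_set (cball 0 R \<inter> ball ?R \<delta>)) (subtopology X U) u"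
    unfolding continuous_map_in_subtopology
    using continuous_map_from_subtopology_mono[OF ii, of "cball 0 R \<inter> ball ?R \<delta>"] \<delta>(2) by auto
  from continuous_map_compose[OF this complex_chart_continuous_map[OF c\<phi>]]
  have w: "continuous_on (cball 0 R \<inter> ball ?R \<delta>) (\<phi> \<circ> u)"
    by simp
  have \<Lambda>_inv: "\<Lambda> ((\<phi> \<circ> u) z) = z" if "z \<in> ball 0 R \<inter> ball ?R \<delta>" for z
    using that \<delta>(2) i[of z] by (subgoal_tac "u z \<in> U") (auto simp: \<Lambda>_def inv)
  have G0_eq: "G0 ((\<phi> \<circ> u) z) = (g \<circ> u) z" if "z \<in> ball 0 R \<inter> ball ?R \<delta>" for z
    using that \<delta>(2) by (subgoal_tac "u z \<in> U") (auto simp: G0_def inv)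

  obtain G \<epsilon> where G: "G analytic_on {0}" "deriv G 0 \<noteq> 0" and \<epsilon>: "\<epsilon> > 0"
    and fG: "\<And>z. z \<in> ball ?R \<epsilon> \<inter> ball 0 R \<Longrightarrow> G0 ((\<phi> \<circ> u) z) = G (csqrt (?R - z))"
  proof (rule sqrt_branch_at_critical_point[OF R \<Lambda>_an _ _ G0_an \<delta>(1) w _ \<Lambda>_inv])
    show "deriv \<Lambda> 0 = 0" "deriv (deriv \<Lambda>) 0 \<noteq> 0" "(\<phi> \<circ> u) ?R = 0"
      using iii iv chart(3) by (simp_all add: \<Lambda>_def numeral_2_eq_2)
  qed (use vi that in \<open>auto simp: G0_def\<close>)
  \<comment> \<open>The minimum is taken because the chart expression equals
    \<open>g \<circ> u\<close> only within \<open>\<delta>\<close>, and the radius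
    \<open>\<epsilon>\<close> is not known to be smaller.\<close>
  have fG': "(g \<circ> u) z = G (csqrt (?R - z))" if "z \<in> ball ?R (min \<delta> \<epsilon>) \<inter> ball 0 R" for z
    using that fG[of z] G0_eq[of z] by auto
  define C where "C = deriv G 0 * of_real (sqrt R) * inverse (Gamma (- 1 / 2 :: complex))"
  \<comment> \<open>In HOL \<open>Gamma\<close> takes the value 0 exactly at its poles, so
    \<open>C\<close> is nonzero once \<open>- 1 / 2\<close> is known not to be a pole.\<close>
  have "(- 1 / 2 :: complex) \<notin> \<int>\<^sub>\<le>\<^sub>0"
  proof
    assume "(- 1 / 2 :: complex) \<in> \<int>\<^sub>\<le>\<^sub>0"
    then obtain n where "(- 1 / 2 :: complex) = - of_nat n" by (elim nonpos_Ints_cases')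
    then have "complex_of_nat 1 = of_nat (2 * n)" by (simp add: mult.commute)
    then have "1 = 2 * n" by (simp only: of_nat_eq_iff)
    then show False by presburger
  qed
  then have C: "C \<noteq> 0"
    using G(2) R by (simp add: C_def Gamma_eq_zero_iff)
  have "\<exists>q. inv_expansion K (\<lambda>n. fps_nth a n * ?R ^ n * of_real (real n powr (3/2))) q \<and>
      (K \<ge> 1 \<longrightarrow> coeff q 0 = C)" for K
  proof -
    have "min \<delta> \<epsilon> > 0" using \<delta>(1) \<epsilon> by simp
    from sqrt_singularity_inv_expansion[OF R hol a sphere G(1) this fG', of K]
    show ?thesis unfolding C_def by blast
  qed
  then show ?thesis
    by (rule coeff_expansion_ex_unique[OF R C])
qed

end
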